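(* In the setting of the triangular array described in the context, suppose: (i) $H$ has an a.e. positive density $h$ with $\|h\|_\infty:=\sup_{x\in\mathbb{R}}h(x)<\infty$; (ii) $\int|x|h(x)\,dx<\infty$; (iii) $n^{-1}\sum_{i=1}^n\gamma_{ni}^2=O_p(1)$ and $\max_{1\le i\le n}n^{-1/2}|\gamma_{ni}|=o_p(1)$; (iv) $\max_{1\le i\le n}|\xi_{ni}|=o_p(1)$ and $\max_{1\le i\le n}|\tau_{ni}|=o_p(1)$. Then $$\sup_{x\in\mathbb{R}}|\tilde U_n(x)-U_n^*(x)|=o_p(1).$$
   Context: For each $n\ge1$, $(\eta_{ni},\gamma_{ni},\tau_{ni},\xi_{ni})$, $1\le i\le n$, is an array of 4-tuples of real random variables defined on a probability space such that $\{\eta_{ni},1\le i\le n\}$ are i.i.d. with distribution function $H$, and $\eta_{ni}$ is independent of $(\gamma_{ni},\tau_{ni},\xi_{ni})$, $1\le i\le n$. Furthermore, $\{\mathcal{A}_{ni}\}$ is an array of sub-$\sigma$-fields such that $\mathcal{A}_{ni}\subset\mathcal{A}_{n,i+1}$, $1\le i\le n$, $n\ge1$; $(\gamma_{n1},\tau_{n1},\xi_{n1})$ is $\mathcal{A}_{n1}$-measurable; the random variables $\{\eta_{n1},\ldots,\eta_{n,j-1};(\gamma_{ni},\tau_{ni},\xi_{ni}),1\le i\le j\}$ are $\mathcal{A}_{nj}$-measurable for $2\le j\le n$; and $\eta_{nj}$ is independent of $\mathcal{A}_{nj}$ for $1\le j\le n$. For $x\in\mathbb{R}$ define $$\tilde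 U_n(x):=n^{-1/2}\sum_{i=1}^n\gamma_{ni}\left[I(\eta_{ni}\le x+x\tau_{ni}+\xi_{ni})-H(x+x\tau_{ni}+\xi_{ni})\right],$$ $$U_n^*(x):=n^{-1/2}\sum_{i=1}^n\gamma_{ni}\left[I(\eta_{ni}\le x)-H(x)\right].$$ *)

theory Defs
  imports "HOL-Probability.Probability"
begin

text \<open>
  Stochastic order symbols for a sequence of real random variables indexed by \<open>n \<ge> 1\<close>.
  Measurability is part of the definitions because \<open>prob_space.prob M\<close> is \<open>0\<close> on
  non-measurable sets; for a supremum over \<open>x \<in> \<real>\<close> it is not automatic.
\<close>

definition bounded_in_prob :: "'a measure \<Rightarrow> (nat \<Rightarrow> 'a \<Rightarrow> real) \<Rightarrow> bool" where
  "bounded_in_prob M X \<longleftrightarrow>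
     (\<forall>n\<ge>1. X n \<in> borel_measurable M) \<and>
     (\<forall>\<epsilon>>0. \<exists>K. \<forall>n\<ge>1. measure M {\<omega> \<in> space M. \<bar>X n \<omega>\<bar> > K} \<le> \<epsilon>)"

definition null_in_prob :: "'a measure \<Rightarrow> (nat \<Rightarrow> 'a \<Rightarrow> real) \<Rightarrow> bool" where
  "null_in_prob M X \<longleftrightarrow>
     (\<forall>n\<ge>1. X n \<in> borel_measurable M) \<and>
     (\<forall>\<epsilon>>0. (\<lambda>n. measure M {\<omega> \<in> space M. \<bar>X n \<omega>\<bar> > \<epsilon>}) \<longlonglongrightarrow> 0)"

definition is_density_of :: "(real \<Rightarrow> real) \<Rightarrow> (real \<Rightarrow> real) \<Rightarrow> bool" where
  "is_density_of h H \<longleftrightarrow>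
     h \<in> borel_measurable borel \<and> (\<forall>x. 0 \<le> h x) \<and> integrable lborel h \<and>
     (\<forall>x. H x = (LBINT t:{..x}. h t))"

text \<open>
  The arrays are total functions of \<open>n\<close> and \<open>i\<close>; only the entries with \<open>1 \<le> i \<le> n\<close>
  (for the \<open>\<sigma>\<close>-fields \<open>1 \<le> i \<le> n + 1\<close>) are constrained.
  Independence of variables with different ranges is stated through the \<open>\<sigma>\<close>-fields they
  generate, since \<open>indep_var\<close> needs a common range type.
\<close>

locale weighted_array = prob_space M for M :: "'a measure" +
  fixes \<eta> \<gamma> \<tau> \<xi> :: "nat \<Rightarrow> nat \<Rightarrow> 'a \<Rightarrow> real"
    and \<A> :: "nat \<Rightarrow> nat \<Rightarrow> 'a measure"
    and H :: "real \<Rightarrow> real"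
  assumes random_variables:
      "\<And>n i. 1 \<le> i \<Longrightarrow> i \<le> n \<Longrightarrow>
        random_variable borel (\<eta> n i) \<and> random_variable borel (\<gamma> n i) \<and>
        random_variable borel (\<tau> n i) \<and> random_variable borel (\<xi> n i)"
    and eta_indep: "\<And>n. 1 \<le> n \<Longrightarrow> indep_vars (\<lambda>_. borel) (\<eta> n) {1..n}"
    and eta_cdf: "\<And>n i. 1 \<le> i \<Longrightarrow> i \<le> n \<Longrightarrow> cdf (distr M borel (\<eta> n i)) = H"
    and eta_indep_weights:
      "\<And>n i. 1 \<le> i \<Longrightarrow> i \<le> n \<Longrightarrow>
        indep_set (sets (vimage_algebra (space M) (\<eta> n i) borel))
          (sets (vimage_algebra (space M)
            (\<lambda>\<omega>. (\<gamma> n i \<omega>, \<tau> n i \<omega>, \<xi> n i \<omega>)) borel))"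
    and sub_sigma_field: "\<And>n i. 1 \<le> n \<Longrightarrow> 1 \<le> i \<Longrightarrow> i \<le> n + 1 \<Longrightarrow> subalgebra M (\<A> n i)"
    and filtration: "\<And>n i. 1 \<le> i \<Longrightarrow> i \<le> n \<Longrightarrow> sets (\<A> n i) \<subseteq> sets (\<A> n (i + 1))"
    and eta_adapted:
      "\<And>n i j. 1 \<le> i \<Longrightarrow> i < j \<Longrightarrow> j \<le> n \<Longrightarrow> \<eta> n i \<in> borel_measurable (\<A> n j)"
    and weights_adapted:
      "\<And>n i j. 1 \<le> i \<Longrightarrow> i \<le> j \<Longrightarrow> j \<le> n \<Longrightarrow>
        \<gamma> n i \<in> borel_measurable (\<A> n j) \<and> \<tau> n i \<in> borel_measurable (\<A> n j) \<and>
        \<xi> n i \<in> borel_measurable (\<A> n j)"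
    and eta_indep_past:
      "\<And>n j. 1 \<le> j \<Longrightarrow> j \<le> n \<Longrightarrow>
        indep_set (sets (vimage_algebra (space M) (\<eta> n j) borel)) (sets (\<A> n j))"

definition U_tilde ::
  "(nat \<Rightarrow> nat \<Rightarrow> 'a \<Rightarrow> real) \<Rightarrow> (nat \<Rightarrow> nat \<Rightarrow> 'a \<Rightarrow> real) \<Rightarrow> (nat \<Rightarrow> nat \<Rightarrow> 'a \<Rightarrow> real) \<Rightarrow>
   (nat \<Rightarrow> nat \<Rightarrow> 'a \<Rightarrow> real) \<Rightarrow> (real \<Rightarrow> real) \<Rightarrow> nat \<Rightarrow> 'a \<Rightarrow> real \<Rightarrow> real" where
  "U_tilde \<eta> \<gamma> \<tau> \<xi> H n \<omega> x =
     1 / sqrt (real n) *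
     (\<Sum>i=1..n. \<gamma> n i \<omega> *
        (of_bool (\<eta> n i \<omega> \<le> x + x * \<tau> n i \<omega> + \<xi> n i \<omega>) -
         H (x + x * \<tau> n i \<omega> + \<xi> n i \<omega>)))"

definition U_star ::
  "(nat \<Rightarrow> nat \<Rightarrow> 'a \<Rightarrow> real) \<Rightarrow> (nat \<Rightarrow> nat \<Rightarrow> 'a \<Rightarrow> real) \<Rightarrow> (real \<Rightarrow> real) \<Rightarrow>
   nat \<Rightarrow> 'a \<Rightarrow> real \<Rightarrow> real" where
  "U_star \<eta> \<gamma> H n \<omega> x =
     1 / sqrt (real n) * (\<Sum>i=1..n. \<gamma> n i \<omega> * (of_bool (\<eta> n i \<omega> \<le> x) - H x))"

end

theory Submission
  imports Defs
begin

text \<open>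
  Write X for \<open>U_tilde\<close> and Y for \<open>U_star\<close>. Both have the form X(t) = sum
  of c_i (1(eta_i \<le> L_i(t)) - H(L_i(t))) with c_i = gamma_i / sqrt n and affine maps L_i that,
  like c_i, are known before eta_i is drawn; so the partial sums of every increment of X form a
  martingale. Fix a mesh 1/m. After replacing c_i by 0 as soon as the sum of squares would pass K,
  or |c_i|, |tau_i| or |xi_i| passes 1/m, the maps L_i that still matter are increasing and all
  bounds are deterministic; by the hypotheses the replacement changes nothing outside an event whose
  probability is small for large n.

  The supremum over all real t is controlled cell by cell, on the cells [k/m, (k+1)/m] with k an
  integer. Let P_k be the mass that H gives to a window around k/m containing all L_i(t) for t in
  the cell. Three facts carry the proof.

  (1) Moments. An increment D over an interval whose conditional probabilities are at most p
  satisfies E D^4 \<le> 8 K^2 p^2 + 3 K p / m^2, and for two adjacent increments D, E with bounds p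
  and q one has E D^2 E^2 \<le> 11 K^2 p q: the two indicators are never both 1, so even the
  diagonal terms are of order p q. Since the c_i may depend on the past, these moments are bounded
  by exhibiting supermartingales of the form D^2 E^2 + (remaining budget) * (lower order terms);
  this takes the place of a maximal inequality (\<open>product_potential_step\<close>,
  \<open>fourth_power_potential_step\<close>, \<open>potential_supermartingale\<close>).

  (2) Chaining. Billingsley's device of the smaller of two adjacent increments needs only the
  product moment. As H is Lipschitz, p is at most min(C l / 2^j, P_k) on the dyadic intervals of
  level j in a cell of length l = 1/m. Thresholds that decay geometrically on both sides of the
  level where the two terms balance make the failure probability at most a constant times K^2 P_k /
  m. With the fourth moment of the increment over the whole cell this bounds the oscillation of X
  and of Y on the cell, and the same fourth moment bounds X - Y at the left endpoint
  (\<open>chaining_thresholds\<close>, \<open>cell_oscillation\<close>,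
  \<open>grid_deviation\<close>).

  (3) Summation over k. The window of k has radius 3 (1 + |k/m|) / m, so a point y lies in at most
  13 (1 + |y|) windows, for every m \<ge> 6. Hence the sum of all P_k is at most 13 E(1 + |eta|),
  which is where the first moment of h enters; the same moment with boundedness of h gives P_k = O(1
  / sqrt m) uniformly in k. Every failure probability is P_k times a quantity that tends to 0 with
  m, so the total tends to 0 (\<open>sum_windows_le\<close>, \<open>measure_window_le\<close>,
  \<open>uniform_closeness\<close>).
\<close>

section \<open>One-step inequalities for the two potentials\<close>

text \<open>
  Here x and y are the two adjacent increments, r is the part of the budget K not yet spent on
  squared weights, and p, q are the conditional probabilities of the two disjoint events. The left
  side is the conditional mean of the potential after one step of weight c. All terms by which the
  product x^2 y^2 grows in the mean are at most c^2 times the lower order terms, and those are paid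
  by the loss of c^2 from the budget. The constants make both sides balance: the growth contributes
  4 = 1 + 2 + 1 terms \<open>k * Q * D\<^sup>2\<close>, and the terms \<open>R * k * (P * Q)\<close>
  satisfy 2 * 11 = 8 + 3 + 11.
\<close>

lemma product_potential_step:
  fixes c p q P Q D E R :: real
  assumes p: "0 \<le> p" "p \<le> P" and q: "0 \<le> q" "q \<le> Q" and pq: "p + q \<le> 1"
    and P1: "P \<le> 1" "Q \<le> 1" and R: "c\<^sup>2 \<le> R"
  defines "\<phi> \<equiv> \<lambda>x y r. x\<^sup>2 * y\<^sup>2 + 4 * r * (Q * x\<^sup>2 + P * y\<^sup>2) + 11 * r\<^sup>2 * (P * Q)"
  shows "p * \<phi> (D + c * (1 - p)) (E - c * q) (R - c\<^sup>2) + q * \<phi> (D - c * p) (E + c * (1 - q)) (R - c\<^sup>2)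
    + (1 - p - q) * \<phi> (D - c * p) (E - c * q) (R - c\<^sup>2) \<le> \<phi> D E R"
proof -
  define k where "k = c\<^sup>2"
  have k0: "0 \<le> k" "k \<le> R" using R by (auto simp: k_def)
  have P0: "0 \<le> P" "0 \<le> Q" using p q by auto
  have pq0: "0 \<le> p * q" "p * q \<le> P * Q" using p q by (auto intro: mult_mono)
  have D2: "p * (D + c * (1 - p))\<^sup>2 + q * (D - c * p)\<^sup>2 + (1 - p - q) * (D - c * p)\<^sup>2 = D\<^sup>2 + k * (p
      * (1 - p))"
    by (simp add: k_def power2_eq_square algebra_simps)
  have E2: "p * (E - c * q)\<^sup>2 + q * (E + c * (1 - q))\<^sup>2 + (1 - p - q) * (E - c * q)\<^sup>2 = E\<^sup>2 + k * (q
      * (1 - q))"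
    by (simp add: k_def power2_eq_square algebra_simps)
  have DE: "p * ((D + c * (1 - p))\<^sup>2 * (E - c * q)\<^sup>2) + q * ((D - c * p)\<^sup>2 * (E + c * (1 - q))\<^sup>2)
      + (1 - p - q) * ((D - c * p)\<^sup>2 * (E - c * q)\<^sup>2)
    = D\<^sup>2 * E\<^sup>2 + k * (p * (1 - p)) * E\<^sup>2 + k * (q * (1 - q)) * D\<^sup>2 - 4 * k * (p * q) * (D * E)
      + 2 * k * (p * q) * (2 * p - 1) * (c * E) + 2 * k * (p * q) * (2 * q - 1) * (c * D)
      + k * k * (p * q) * (p + q - 3 * (p * q))"
    unfolding k_def by algebra
  have pv: "p * (1 - p) \<le> P"
    using p mult_left_le[of "1 - p" p] by simp
  have qv: "q * (1 - q) \<le> Q"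
    using q mult_left_le[of "1 - q" q] by simp
  have b1: "k * (p * (1 - p)) * E\<^sup>2 \<le> k * P * E\<^sup>2"
    using pv k0 by (intro mult_right_mono mult_left_mono) auto
  have b2: "k * (q * (1 - q)) * D\<^sup>2 \<le> k * Q * D\<^sup>2"
    using qv k0 by (intro mult_right_mono mult_left_mono) auto
  have pqP: "p * q \<le> P" "p * q \<le> Q" 
    using mult_mono[of p P q 1] mult_mono[of p 1 q Q] p q pq by auto
  have kpq: "0 \<le> k * (p * q)" using k0 pq0 by simp
  \<comment> \<open>The mixed terms carry the factor p q, because the two events exclude each other.\<close>
  have b3: "- 4 * k * (p * q) * (D * E) \<le> 2 * k * Q * D\<^sup>2 + 2 * k * P * E\<^sup>2"
  proof -
    have "2 * (- (D * E)) \<le> D\<^sup>2 + E\<^sup>2" using sum_squares_bound[of D "-E"] by simp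
    then have "(2 * (k * (p * q))) * (2 * (- (D * E))) \<le> (2 * (k * (p * q))) * (D\<^sup>2 + E\<^sup>2)"
      using kpq by (intro mult_left_mono) auto
    also have "\<dots> = 2 * (k * (p * q) * D\<^sup>2) + 2 * (k * (p * q) * E\<^sup>2)" by (simp add: algebra_simps)
    also have "\<dots> \<le> 2 * (k * Q * D\<^sup>2) + 2 * (k * P * E\<^sup>2)"
      using k0 pqP by (intro add_mono mult_left_mono mult_right_mono) auto
    finally show ?thesis by (simp add: algebra_simps)
  qed
  have amgm: "2 * \<bar>x * y\<bar> \<le> x\<^sup>2 + y\<^sup>2" for x y :: real
    using sum_squares_bound[of "\<bar>x\<bar>" "\<bar>y\<bar>"] by (simp add: abs_mult)
  have b4: "2 * k * (p * q) * (2 * r - 1) * (c * x) \<le> k * S * x\<^sup>2 + k * k * (p * q)"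
    if "0 \<le> r" "r \<le> 1" "p * q \<le> S" for r x S
  proof -
    have "\<bar>(2 * r - 1) * (c * x)\<bar> \<le> 1 * \<bar>c * x\<bar>"
      unfolding abs_mult[of "2*r-1"] using that by (intro mult_right_mono) auto
    then have "2 * ((2 * r - 1) * (c * x)) \<le> x\<^sup>2 + k"
      using amgm[of c x] unfolding k_def by linarith
    then have "(k * (p * q)) * (2 * ((2 * r - 1) * (c * x))) \<le> (k * (p * q)) * (x\<^sup>2 + k)"
      using kpq by (intro mult_left_mono) auto
    also have "\<dots> = k * (p * q) * x\<^sup>2 + k * k * (p * q)" by (simp add: algebra_simps)
    also have "\<dots> \<le> k * S * x\<^sup>2 + k * k * (p * q)"
      using k0 that by (intro add_right_mono mult_right_mono mult_left_mono) auto
    finally show ?thesis by (simp add: algebra_simps)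
  qed
  have b5: "k * k * (p * q) * (p + q - 3 * (p * q)) \<le> k * k * (p * q)"
    using mult_left_mono[of "p + q - 3 * (p * q)" 1 "k * k * (p * q)"] k0 pq0 pq by simp
  have kk: "k * k * (p * q) \<le> R * k * (P * Q)"
    using k0 pq0 p q by (intro mult_mono) auto
  have s1: "k * k * (P * Q) \<le> R * k * (P * Q)"
    using k0 P0 by (intro mult_right_mono) auto
  have r1: "4 * (R - k) * (Q * (k * (p * (1 - p)))) \<le> 4 * R * (k * (P * Q))"
  proof -
    have "Q * (k * (p * (1 - p))) \<le> Q * (k * P)" using pv k0 P0 by (intro mult_left_mono) auto
    then have "4 * (R - k) * (Q * (k * (p * (1 - p)))) \<le> 4 * (R - k) * (Q * (k * P))"
      by (rule mult_left_mono) (use k0 in auto)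
    also have "\<dots> \<le> 4 * R * (Q * (k * P))"
      by (rule mult_right_mono) (use k0 P0 in auto)
    finally show ?thesis by (simp add: ac_simps)
  qed
  have r2: "4 * (R - k) * (P * (k * (q * (1 - q)))) \<le> 4 * R * (k * (P * Q))"
  proof -
    have "P * (k * (q * (1 - q))) \<le> P * (k * Q)" using qv k0 P0 by (intro mult_left_mono) auto
    then have "4 * (R - k) * (P * (k * (q * (1 - q)))) \<le> 4 * (R - k) * (P * (k * Q))"
      by (rule mult_left_mono) (use k0 in auto)
    also have "\<dots> \<le> 4 * R * (P * (k * Q))"
      by (rule mult_right_mono) (use k0 P0 in auto)
    finally show ?thesis by (simp add: ac_simps)
  qed
  have "p * \<phi> (D + c * (1 - p)) (E - c * q) (R - c\<^sup>2) + q * \<phi> (D - c * p) (E + c * (1 - q)) (R - c\<^sup>2)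
    + (1 - p - q) * \<phi> (D - c * p) (E - c * q) (R - c\<^sup>2)
    = (p * ((D + c * (1 - p))\<^sup>2 * (E - c * q)\<^sup>2) + q * ((D - c * p)\<^sup>2 * (E + c * (1 - q))\<^sup>2)
      + (1 - p - q) * ((D - c * p)\<^sup>2 * (E - c * q)\<^sup>2))
     + 4 * (R - k) * (Q * (p * (D + c * (1 - p))\<^sup>2 + q * (D - c * p)\<^sup>2 + (1 - p - q) * (D - c * p)\<^sup>2)
        + P * (p * (E - c * q)\<^sup>2 + q * (E + c * (1 - q))\<^sup>2 + (1 - p - q) * (E - c * q)\<^sup>2))
     + 11 * (R - k)\<^sup>2 * (P * Q)"
    unfolding \<phi>_def k_def[symmetric] by algebra
  also have "\<dots> = (D\<^sup>2 * E\<^sup>2 + k * (p * (1 - p)) * E\<^sup>2 + k * (q * (1 - q)) * D\<^sup>2 - 4 * k * (p * q) * (D * E)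
      + 2 * k * (p * q) * (2 * p - 1) * (c * E) + 2 * k * (p * q) * (2 * q - 1) * (c * D)
      + k * k * (p * q) * (p + q - 3 * (p * q)))
     + 4 * (R - k) * (Q * (D\<^sup>2 + k * (p * (1 - p))) + P * (E\<^sup>2 + k * (q * (1 - q))))
     + 11 * (R - k)\<^sup>2 * (P * Q)"
    unfolding D2 E2 DE ..
  also have "\<dots> = (D\<^sup>2 * E\<^sup>2 + k * (p * (1 - p)) * E\<^sup>2 + k * (q * (1 - q)) * D\<^sup>2 - 4 * k * (p * q) * (D * E)
      + 2 * k * (p * q) * (2 * p - 1) * (c * E) + 2 * k * (p * q) * (2 * q - 1) * (c * D)
      + k * k * (p * q) * (p + q - 3 * (p * q)))
     + 4 * R * (Q * D\<^sup>2 + P * E\<^sup>2) - 4 * (k * Q * D\<^sup>2) - 4 * (k * P * E\<^sup>2)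
     + 4 * (R - k) * (Q * (k * (p * (1 - p)))) + 4 * (R - k) * (P * (k * (q * (1 - q))))
     + 11 * R\<^sup>2 * (P * Q) - 22 * (R * k * (P * Q)) + 11 * (k * k * (P * Q))"
    by (simp add: power2_eq_square algebra_simps)
  also have "\<dots> \<le> \<phi> D E R"
    unfolding \<phi>_def
    using b1 b2 b3 b4[of p P E] b4[of q Q D] b5 kk s1 r1 r2 pqP p q pq
    by (simp add: mult.assoc)
  finally show ?thesis .
qed

text \<open>
  The analogue for a single increment. The diagonal term c^4 p is only of first order in p; bounding
  c^2 by L^2 makes it negligible when all weights are small.
\<close>

lemma fourth_power_potential_step:
  fixes c p P D R L :: real
  assumes p: "0 \<le> p" "p \<le> P" "p \<le> 1" and R: "c\<^sup>2 \<le> R" and L: "c\<^sup>2 \<le> L\<^sup>2"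
  defines "\<phi> \<equiv> \<lambda>x r. x ^ 4 + 8 * r * (P * x\<^sup>2) + 8 * r\<^sup>2 * P\<^sup>2 + 3 * L\<^sup>2 * r * P"
  shows "p * \<phi> (D + c * (1 - p)) (R - c\<^sup>2) + (1 - p) * \<phi> (D - c * p) (R - c\<^sup>2) \<le> \<phi> D R"
proof -
  define k where "k = c\<^sup>2"
  have k0: "0 \<le> k" "k \<le> R" "k \<le> L\<^sup>2" using R L by (auto simp: k_def)
  define v where "v = p * (1 - p)"
  have v: "0 \<le> v" "v \<le> P"
    using p mult_left_le[of "1 - p" p] by (auto simp: v_def)
  have P0: "0 \<le> P" using p by simp
  have D2: "p * (D + c * (1 - p))\<^sup>2 + (1 - p) * (D - c * p)\<^sup>2 = D\<^sup>2 + k * v"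
    by (simp add: k_def v_def power2_eq_square algebra_simps)
  have D4: "p * (D + c * (1 - p)) ^ 4 + (1 - p) * (D - c * p) ^ 4
     = D ^ 4 + 6 * (k * v * D\<^sup>2) + 4 * (k * v) * ((1 - 2 * p) * (c * D)) + k * k * v * (1 - 3 * v)"
    unfolding k_def v_def by algebra
  have b1: "k * v * D\<^sup>2 \<le> k * P * D\<^sup>2" using k0 v by (intro mult_right_mono mult_left_mono) auto
  have kv: "k * k * v \<le> L\<^sup>2 * k * P" using k0 v by (intro mult_mono) auto
  have amgm: "2 * \<bar>x * y\<bar> \<le> x\<^sup>2 + y\<^sup>2" for x y :: real
    using sum_squares_bound[of "\<bar>x\<bar>" "\<bar>y\<bar>"] by (simp add: abs_mult)
  have b2: "4 * (k * v) * ((1 - 2 * p) * (c * D)) \<le> 2 * (k * P * D\<^sup>2) + 2 * (L\<^sup>2 * k * P)"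
  proof -
    have "\<bar>(1 - 2 * p) * (c * D)\<bar> \<le> 1 * \<bar>c * D\<bar>"
      unfolding abs_mult[of "1 - 2*p"] using p by (intro mult_right_mono) auto
    then have "2 * ((1 - 2 * p) * (c * D)) \<le> D\<^sup>2 + k"
      using amgm[of c D] unfolding k_def by linarith
    then have "(2 * (k * v)) * (2 * ((1 - 2 * p) * (c * D))) \<le> (2 * (k * v)) * (D\<^sup>2 + k)"
      using k0 v by (intro mult_left_mono) auto
    also have "\<dots> = 2 * (k * v * D\<^sup>2) + 2 * (k * k * v)" by (simp add: algebra_simps)
    finally show ?thesis using b1 kv by (simp add: algebra_simps)
  qed
  have b3: "k * k * v * (1 - 3 * v) \<le> L\<^sup>2 * k * P"
    using mult_left_mono[of "1 - 3 * v" 1 "k * k * v"] k0 v kv by simp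
  have r1: "8 * (R - k) * (P * (k * v)) \<le> 8 * R * (k * P\<^sup>2)"
  proof -
    have "8 * (R - k) * (P * (k * v)) \<le> 8 * R * (P * (k * P))"
      using k0 v P0 by (intro mult_mono mult_left_mono) auto
    then show ?thesis by (simp add: power2_eq_square ac_simps)
  qed
  have s1: "k * k * P\<^sup>2 \<le> R * k * P\<^sup>2" using k0 by (intro mult_right_mono) auto
  have "p * \<phi> (D + c * (1 - p)) (R - c\<^sup>2) + (1 - p) * \<phi> (D - c * p) (R - c\<^sup>2)
   = (p * (D + c * (1 - p)) ^ 4 + (1 - p) * (D - c * p) ^ 4)
     + 8 * (R - k) * (P * (p * (D + c * (1 - p))\<^sup>2 + (1 - p) * (D - c * p)\<^sup>2))
     + 8 * (R - k)\<^sup>2 * P\<^sup>2 + 3 * L\<^sup>2 * (R - k) * P"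
    unfolding \<phi>_def k_def[symmetric] by algebra
  also have "\<dots> = D ^ 4 + 6 * (k * v * D\<^sup>2) + 4 * (k * v) * ((1 - 2 * p) * (c * D)) + k * k * v * (1 - 3 * v)
     + 8 * R * (P * D\<^sup>2) - 8 * (k * P * D\<^sup>2) + 8 * (R - k) * (P * (k * v))
     + 8 * R\<^sup>2 * P\<^sup>2 - 16 * (R * k * P\<^sup>2) + 8 * (k * k * P\<^sup>2) + 3 * L\<^sup>2 * R * P - 3 * (L\<^sup>2 * k * P)"
    unfolding D2 D4 by (simp add: power2_eq_square algebra_simps)
  also have "\<dots> \<le> \<phi> D R"
    unfolding \<phi>_def using b1 b2 b3 r1 s1 by (simp add: mult.assoc)
  finally show ?thesis .
qed

section \<open>Three-point chaining on a dyadic grid\<close>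

lemma sum_geometric_around_le:
  fixes x :: real
  assumes "0 \<le> x" "x < 1"
  shows "(\<Sum>j<J. x ^ ((j - j0) + (j0 - j))) \<le> 2 / (1 - x)"
proof -
  have geo: "(\<Sum>j<k. x ^ j) \<le> 1 / (1 - x)" for k
  proof -
    have "(\<Sum>j<k. x ^ j) = (1 - x ^ k) / (1 - x)" using assms by (simp add: sum_gp_strict)
    also have "\<dots> \<le> 1 / (1 - x)" using assms by (intro divide_right_mono) auto
    finally show ?thesis .
  qed
  have "(\<Sum>j<J. x ^ ((j - j0) + (j0 - j))) \<le> (\<Sum>j<j0 + J. x ^ ((j - j0) + (j0 - j)))"
    using assms by (intro sum_mono2) auto
  also have "\<dots> = (\<Sum>j<j0. x ^ (j0 - j)) + (\<Sum>j<J. x ^ j)"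
  proof -
    have "(\<Sum>j<j0 + J. x ^ ((j - j0) + (j0 - j))) = (\<Sum>j<j0. x ^ ((j - j0) + (j0 - j))) + (\<Sum>j=j0..<j0
        + J. x ^ ((j - j0) + (j0 - j)))"
      unfolding lessThan_atLeast0 by (rule sum.atLeastLessThan_concat[symmetric]) auto
    also have "(\<Sum>j=j0..<j0 + J. x ^ ((j - j0) + (j0 - j))) = (\<Sum>j<J. x ^ j)"
      using sum.shift_bounds_nat_ivl[of "\<lambda>j. x ^ ((j - j0) + (j0 - j))" 0 j0 J]
      by (simp add: lessThan_atLeast0 add.commute)
    finally show ?thesis by simp
  qed
  also have "(\<Sum>j<j0. x ^ (j0 - j)) \<le> (\<Sum>j<j0. x ^ (j0 - Suc j))"
    using assms by (intro sum_mono power_decreasing) auto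
  also have "\<dots> = (\<Sum>j<j0. x ^ j)" by (rule sum.nat_diff_reindex)
  finally show ?thesis using geo[of j0] geo[of J] by simp
qed

text \<open>
  The terms 2^j min(A / 2^j, P)^2 grow geometrically up to the level j0 at which A / 2^j drops below
  P, and decrease geometrically afterwards, with ratio 1/2 both times. Thresholds of ratio 9/10 on
  either side of j0 are summable, and their fourth powers (ratio 0.6561 > 1/2) do not destroy the
  summability of the terms. The bound is linear in P, which is what allows a sum over all cells; a
  choice of thresholds independent of P would lose this.
\<close>

lemma chaining_thresholds:
  fixes A P :: real
  assumes A: "0 < A" and P: "0 \<le> P"
  obtains \<beta> :: "nat \<Rightarrow> real" where "\<And>j. 0 < \<beta> j" "\<And>J. (\<Sum>j<J. \<beta> j) \<le> 1"
    "\<And>J. (\<Sum>j<J. 2 ^ j * (min (A / 2 ^ j) P)\<^sup>2 / \<beta> j ^ 4) \<le> 3200000 * (A * P)"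
proof (cases "P = 0")
  case True
  define \<beta> :: "nat \<Rightarrow> real" where "\<beta> j = (1/2) ^ Suc j" for j
  have "(\<Sum>j<J. \<beta> j) = 1 - (1/2) ^ J" for J by (induction J) (auto simp: \<beta>_def)
  moreover have "min (A / 2 ^ j) P = 0" for j using A True by simp
  ultimately show ?thesis using that[of \<beta>] True by (simp add: \<beta>_def)
next
  case False
  then have P: "0 < P" using P by simp
  \<comment> \<open>The level j0 at which the two terms of the minimum balance.\<close>
  obtain k where "A / P < 2 ^ k" using real_arch_pow[of 2 "A / P"] by auto
  then have k: "A / 2 ^ k \<le> P" using P by (simp add: field_simps)
  define j0 where "j0 = (LEAST j. A / 2 ^ j \<le> P)"
  have j0: "A / 2 ^ j0 \<le> P" unfolding j0_def using k by (rule LeastI)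
  define d where "d j = (j - j0) + (j0 - j)" for j
  define \<beta> :: "nat \<Rightarrow> real" where "\<beta> j = (9/10) ^ d j / 20" for j
  have pos: "0 < \<beta> j" for j by (simp add: \<beta>_def)
  have s: "(\<Sum>j<J. \<beta> j) \<le> 1" for J
    using sum_geometric_around_le[of "9/10" j0 J] by (simp add: \<beta>_def d_def flip: sum_divide_distrib)
  have t: "2 ^ j * (min (A / 2 ^ j) P)\<^sup>2 \<le> 2 * (A * P) * (1/2) ^ d j" for j
  proof (cases "j0 \<le> j")
    case True
    then obtain i where i: "j = j0 + i" using le_Suc_ex by blast
    have "2 ^ j * (min (A / 2 ^ j) P)\<^sup>2 \<le> 2 ^ j * (A / 2 ^ j)\<^sup>2"
      using A P by (intro mult_left_mono power_mono) auto
    also have "\<dots> = A * (A / 2 ^ j0) * (1/2) ^ i"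
      by (simp add: i power2_eq_square power_add field_simps)
    also have "\<dots> \<le> A * P * (1/2) ^ i"
      using A j0 by (intro mult_right_mono mult_left_mono) auto
    also have "\<dots> \<le> 2 * (A * P) * (1/2) ^ i" using A P by simp
    finally show ?thesis by (simp add: d_def i)
  next
    case False
    then obtain i where i: "j0 = j + Suc i" by (auto simp: not_le less_iff_Suc_add)
    have "\<not> A / 2 ^ (j + i) \<le> P"
      using not_less_Least[of "j + i" "\<lambda>j. A / 2 ^ j \<le> P"] i unfolding j0_def by simp
    then have "2 ^ j * P \<le> A * (1/2) ^ i" by (simp add: field_simps power_add)
    then have le: "2 ^ j * P * P \<le> A * (1/2) ^ i * P" using P by (intro mult_right_mono) auto
    have "2 ^ j * (min (A / 2 ^ j) P)\<^sup>2 \<le> 2 ^ j * P\<^sup>2"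
      using A P by (intro mult_left_mono power_mono) auto
    also have "\<dots> = 2 ^ j * P * P" by (simp add: power2_eq_square)
    also note le
    finally show ?thesis by (simp add: d_def i ac_simps)
  qed
  have "(\<Sum>j<J. 2 ^ j * (min (A / 2 ^ j) P)\<^sup>2 / \<beta> j ^ 4) \<le> 3200000 * (A * P)" for J
  proof -
    \<comment> \<open>Here 320000 = 2 * 20 ^ 4, and 4/5 exceeds the ratio 0.5 / 0.6561; the two-sided sum of its powers is at most 10.\<close>
    have "(\<Sum>j<J. 2 ^ j * (min (A / 2 ^ j) P)\<^sup>2 / \<beta> j ^ 4) \<le> (\<Sum>j<J. 320000 * (A * P) * (4/5) ^ d j)"
    proof (rule sum_mono)
      fix j
      have "2 ^ j * (min (A / 2 ^ j) P)\<^sup>2 / \<beta> j ^ 4 \<le> 2 * (A * P) * (1/2) ^ d j / \<beta> j ^ 4"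
        using t pos[of j] by (intro divide_right_mono) auto
      also have "\<dots> = 320000 * (A * P) * ((1/2) ^ d j / ((9/10) ^ 4) ^ d j)"
      proof -
        have "((9/10::real) ^ d j) ^ 4 = ((9/10) ^ 4) ^ d j"
          by (simp only: power_mult[symmetric] mult.commute)
        then have \<beta>4: "\<beta> j ^ 4 = ((9/10) ^ 4) ^ d j / 160000"
          unfolding \<beta>_def power_divide[of _ 20] by simp
        have "2 * (A * P) * y / (z / 160000) = 320000 * (A * P) * (y / z)" for y z by simp
        then show ?thesis unfolding \<beta>4 .
      qed
      also have "(1/2) ^ d j / ((9/10) ^ 4) ^ d j = ((1/2) / (9/10) ^ 4 :: real) ^ d j"
        by (simp only: power_divide)
      also have "320000 * (A * P) * ((1/2) / (9/10) ^ 4) ^ d j \<le> 320000 * (A * P) * (4/5) ^ d j"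
        using A P by (intro mult_left_mono power_mono) (auto simp: power_divide)
      finally show "2 ^ j * (min (A / 2 ^ j) P)\<^sup>2 / \<beta> j ^ 4 \<le> 320000 * (A * P) * (4/5) ^ d j" .
    qed
    also have "\<dots> = 320000 * (A * P) * (\<Sum>j<J. (4/5) ^ d j)" by (simp add: sum_distrib_left)
    also have "\<dots> \<le> 320000 * (A * P) * 10"
      using A P sum_geometric_around_le[of "4/5" j0 J] by (intro mult_left_mono) (auto simp: d_def)
    finally show ?thesis by simp
  qed
  then show ?thesis using that pos s by blast
qed

definition dyadic :: "real \<Rightarrow> real \<Rightarrow> nat \<Rightarrow> nat \<Rightarrow> real" where
  "dyadic a l j i = a + l * real i / 2 ^ j"

lemma dyadic_double: "dyadic a l (Suc j) (2 * i) = dyadic a l j i"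
  by (simp add: dyadic_def)

text \<open>
  At a new point of level J + 1 the value of f differs by at most \<open>\<beta> J\<close> from that
  at one of the two neighbours of level J. So the smaller of its distances to the two end values of
  f exceeds that of the neighbour by at most \<open>\<beta> J\<close>.
\<close>

lemma dyadic_three_point_chaining:
  fixes f :: "real \<Rightarrow> real"
  assumes three: "\<And>j i. i < 2 ^ j \<Longrightarrow>
      min \<bar>f (dyadic a l (Suc j) (2 * i + 1)) - f (dyadic a l j i)\<bar>
          \<bar>f (dyadic a l j (Suc i)) - f (dyadic a l (Suc j) (2 * i + 1))\<bar> \<le> \<beta> j"
  shows "i \<le> 2 ^ J \<Longrightarrow> min \<bar>f (dyadic a l J i) - f a\<bar> \<bar>f (a + l) - f (dyadic a l J i)\<bar> \<le> (\<Sum>j<J. \<beta> j)"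
proof (induction J arbitrary: i)
  case 0
  then have "i = 0 \<or> i = 1" by auto
  then show ?case by (auto simp: dyadic_def)
next
  case (Suc J)
  consider k where "i = 2 * k" "k \<le> 2 ^ J" | k where "i = 2 * k + 1" "k < 2 ^ J"
    using Suc.prems by (cases "even i") (auto elim!: evenE oddE)
  then show ?case
  proof cases
    case 1
    have "0 \<le> \<beta> J" using three[of 0 J] by (auto simp: min_def split: if_splits)
    then show ?thesis using Suc.IH[OF 1(2)] by (simp add: 1(1) dyadic_double)
  next
    case 2
    have "k \<le> 2 ^ J" "Suc k \<le> 2 ^ J" using 2 by auto
    then show ?thesis
      using Suc.IH[of k] Suc.IH[of "Suc k"] three[OF 2(2)] unfolding 2(1) sum.lessThan_Suc
      by (smt (verit))
  qed
qed

lemma right_continuous_bound_from_dyadics: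
  fixes f :: "real \<Rightarrow> real"
  assumes l: "0 < l" and rc: "\<And>t. a \<le> t \<Longrightarrow> t < a + l \<Longrightarrow> continuous (at_right t) f"
    and dy: "\<And>J i. i \<le> 2 ^ J \<Longrightarrow> \<bar>f (dyadic a l J i) - v\<bar> \<le> B"
    and t: "a \<le> t" "t \<le> a + l"
  shows "\<bar>f t - v\<bar> \<le> B"
proof (cases "t = a + l")
  case True
  then show ?thesis using dy[of 1 0] by (simp add: dyadic_def)
next
  case False
  then have t: "a \<le> t" "t < a + l" using t by auto
  define i where "i J = Suc (nat \<lfloor>(t - a) / l * 2 ^ J\<rfloor>)" for J :: nat
  define s where "s J = dyadic a l J (i J)" for J
  have i: "(t - a) / l * 2 ^ J < real (i J)" "real (i J) \<le> (t - a) / l * 2 ^ J + 1" "i J \<le> 2 ^ J" for J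
  proof -
    have 0: "0 \<le> (t - a) / l * 2 ^ J" using t l by simp
    then show "(t - a) / l * 2 ^ J < real (i J)" "real (i J) \<le> (t - a) / l * 2 ^ J + 1"
      unfolding i_def by linarith+
    have "(t - a) / l < 1" using t l by simp
    then have "(t - a) / l * 2 ^ J < 2 ^ J" using mult_strict_right_mono[of "(t-a)/l" 1 "2^J"] by simp
    then have "\<lfloor>(t - a) / l * 2 ^ J\<rfloor> < 2 ^ J" by (simp add: floor_less_iff)
    then show "i J \<le> 2 ^ J" unfolding i_def using 0 by (simp add: Suc_le_eq nat_less_iff)
  qed
  have s1: "t < s J" for J
    using i(1)[of J] l by (simp add: s_def dyadic_def field_simps)
  have s2: "s J \<le> t + l * (1/2) ^ J" for J
  proof -
    have "l * real (i J) \<le> (t - a) * 2 ^ J + l" using i(2)[of J] l by (simp add: field_simps)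
    then have "l * real (i J) / 2 ^ J \<le> ((t - a) * 2 ^ J + l) / 2 ^ J" by (intro divide_right_mono) auto
    also have "\<dots> = t - a + l * (1/2) ^ J" by (simp add: add_divide_distrib power_divide)
    finally show ?thesis by (simp add: s_def dyadic_def)
  qed
  have "s \<longlonglongrightarrow> t"
  proof (rule tendsto_sandwich[of "\<lambda>_. t" _ _ "\<lambda>J. t + l * (1/2) ^ J"])
    have "(\<lambda>J. t + l * (1/2) ^ J) \<longlonglongrightarrow> t + l * 0"
      by (intro tendsto_intros LIMSEQ_power_zero) simp
    then show "(\<lambda>J. t + l * (1/2) ^ J) \<longlonglongrightarrow> t" by simp
  qed (use s1 s2 in \<open>auto intro!: always_eventually less_imp_le\<close>)
  then have "filterlim s (at_right t) sequentially"
    by (auto simp: filterlim_at s1 less_imp_neq[OF s1] intro!: always_eventually)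
  moreover have "(f \<longlongrightarrow> f t) (at_right t)" using rc[OF t] by (simp add: continuous_within)
  ultimately have "(\<lambda>J. f (s J)) \<longlonglongrightarrow> f t" by (rule filterlim_compose[rotated])
  then have "(\<lambda>J. \<bar>f (s J) - v\<bar>) \<longlonglongrightarrow> \<bar>f t - v\<bar>" by (intro tendsto_intros)
  then show ?thesis
    by (rule LIMSEQ_le_const2) (use dy i(3) in \<open>auto simp: s_def\<close>)
qed

section \<open>Integrating out an independent coordinate\<close>

text \<open>
  Conditioning on A without conditional expectations: the joint law of the identity, viewed as a map
  into A, and of Y is a product measure, so Tonelli's theorem applies.
\<close>

lemma (in prob_space) nn_integral_independent_coordinate:
  assumes sub: "subalgebra M A" and Y[measurable]: "random_variable borel Y"
    and indep: "indep_set (sets (vimage_algebra (space M) Y borel)) (sets A)"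
    and f: "f \<in> borel_measurable (A \<Otimes>\<^sub>M borel)"
  shows "(\<integral>\<^sup>+\<omega>. f (\<omega>, Y \<omega>) \<partial>M) = (\<integral>\<^sup>+\<omega>. (\<integral>\<^sup>+y. f (\<omega>, y) \<partial>distr M borel Y) \<partial>M)"
proof -
  have id[measurable]: "(\<lambda>\<omega>. \<omega>) \<in> measurable M A"
    using sub by (auto simp: measurable_def subalgebra_def dest: sets.sets_into_space)
  interpret Y: prob_space "distr M borel Y" by (rule prob_space_distr) simp
  interpret X: prob_space "distr M A (\<lambda>\<omega>. \<omega>)" by (rule prob_space_distr) simp
  have d: "distr M A (\<lambda>\<omega>. \<omega>) \<Otimes>\<^sub>M distr M borel Y = distr M (A \<Otimes>\<^sub>M borel) (\<lambda>\<omega>. (\<omega>, Y \<omega>))"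
  proof (rule pair_measure_eqI)
    fix S T assume "S \<in> sets (distr M A (\<lambda>\<omega>. \<omega>))" "T \<in> sets (distr M borel Y)"
    then have [measurable]: "S \<in> sets A" "T \<in> sets borel" by auto
    have S: "S \<subseteq> space M" "space A = space M"
      using sub sets.sets_into_space[of S A] by (auto simp: subalgebra_def)
    have "prob ((Y -` T \<inter> space M) \<inter> S) = prob (Y -` T \<inter> space M) * prob S"
      using indep in_vimage_algebra[of T borel Y "space M"] unfolding indep_sets2_eq by auto
    moreover have "(\<lambda>\<omega>. (\<omega>, Y \<omega>)) -` (S \<times> T) \<inter> space M = (Y -` T \<inter> space M) \<inter> S"
      "(\<lambda>\<omega>. \<omega>) -` S \<inter> space M = S"
      using S by auto
    ultimately show "emeasure (distr M A (\<lambda>\<omega>. \<omega>)) S * emeasure (distr M borel Y) T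
        = emeasure (distr M (A \<Otimes>\<^sub>M borel) (\<lambda>\<omega>. (\<omega>, Y \<omega>))) (S \<times> T)"
      by (simp add: emeasure_distr emeasure_eq_measure ennreal_mult mult.commute)
  qed (simp_all add: X.sigma_finite_measure_axioms Y.sigma_finite_measure_axioms cong: sets_pair_measure_cong)
  have f'[measurable]: "f \<in> borel_measurable (distr M A (\<lambda>\<omega>. \<omega>) \<Otimes>\<^sub>M distr M borel Y)"
    using f by (subst measurable_cong_sets[OF sets_pair_measure_cong[of _ A _ borel] refl]) simp_all
  have "(\<integral>\<^sup>+\<omega>. f (\<omega>, Y \<omega>) \<partial>M) = (\<integral>\<^sup>+z. f z \<partial>distr M (A \<Otimes>\<^sub>M borel) (\<lambda>\<omega>. (\<omega>, Y \<omega>)))"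
    using f by (subst nn_integral_distr) simp_all
  also have "\<dots> = (\<integral>\<^sup>+z. f z \<partial>(distr M A (\<lambda>\<omega>. \<omega>) \<Otimes>\<^sub>M distr M borel Y))"
    by (simp add: d)
  also have "\<dots> = (\<integral>\<^sup>+x. \<integral>\<^sup>+y. f (x, y) \<partial>distr M borel Y \<partial>distr M A (\<lambda>\<omega>. \<omega>))"
    by (rule Y.nn_integral_fst[OF f', symmetric])
  also have "\<dots> = (\<integral>\<^sup>+\<omega>. (\<integral>\<^sup>+y. f (\<omega>, y) \<partial>distr M borel Y) \<partial>M)"
  proof -
    have "f \<in> borel_measurable (A \<Otimes>\<^sub>M distr M borel Y)"
      using f by (subst measurable_cong_sets[OF sets_pair_measure_cong[of _ A _ borel] refl]) simp_all
    then have "(\<lambda>x. \<integral>\<^sup>+ y. f (x, y) \<partial>distr M borel Y) \<in> borel_measurable A"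
      by (rule Y.borel_measurable_nn_integral_fst)
    then show ?thesis by (subst nn_integral_distr) simp_all
  qed
  finally show ?thesis .
qed

lemma (in prob_space) nn_integral_two_disjoint_events:
  fixes f :: "real \<Rightarrow> real \<Rightarrow> real"
  assumes [measurable]: "I \<in> sets M" "J \<in> sets M" and disj: "I \<inter> J = {}"
    and f0: "0 \<le> f 1 0" "0 \<le> f 0 1" "0 \<le> f 0 0"
  shows "(\<integral>\<^sup>+y. ennreal (f (of_bool (y \<in> I)) (of_bool (y \<in> J))) \<partial>M)
    = ennreal (prob I * f 1 0 + prob J * f 0 1 + (1 - prob I - prob J) * f 0 0)"
proof -
  have un: "prob (I \<union> J) = prob I + prob J" by (rule finite_measure_Union) (use disj in auto)
  have r: "prob (space M - (I \<union> J)) = 1 - prob I - prob J"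
    using prob_compl[of "I \<union> J"] un by simp
  have le: "prob I + prob J \<le> 1" using un prob_le_1[of "I \<union> J"] by simp
  have "(\<integral>\<^sup>+y. ennreal (f (of_bool (y \<in> I)) (of_bool (y \<in> J))) \<partial>M)
    = (\<integral>\<^sup>+y. ennreal (f 1 0) * indicator I y + ennreal (f 0 1) * indicator J y
        + ennreal (f 0 0) * indicator (space M - (I \<union> J)) y \<partial>M)"
    by (rule nn_integral_cong) (use disj in \<open>auto simp: indicator_def\<close>)
  also have "\<dots> = ennreal (f 1 0) * emeasure M I + ennreal (f 0 1) * emeasure M J
        + ennreal (f 0 0) * emeasure M (space M - (I \<union> J))"
    by (simp add: nn_integral_add nn_integral_cmult)
  also have "\<dots> = ennreal (prob I * f 1 0 + prob J * f 0 1 + (1 - prob I - prob J) * f 0 0)"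
    using f0 le unfolding emeasure_eq_measure r
    by (simp add: ennreal_mult ennreal_plus mult.commute)
  finally show ?thesis .
qed

section \<open>Moment bounds for predictably weighted sums\<close>

context weighted_array begin

text \<open>
  The common distribution of all \<open>\<eta> n i\<close>.
\<close>

definition law :: "real measure" where "law = distr M borel (\<eta> 1 1)"

lemma eta_measurable [measurable]: "1 \<le> i \<Longrightarrow> i \<le> n \<Longrightarrow> \<eta> n i \<in> borel_measurable M"
  using random_variables by blast

lemma law_real_distribution: "real_distribution law"
  unfolding law_def by (rule real_distribution_distr) simp

lemma cdf_law: "cdf law = H"
  using eta_cdf[of 1 1] by (simp add: law_def)

lemma distr_eta: "1 \<le> i \<Longrightarrow> i \<le> n \<Longrightarrow> distr M borel (\<eta> n i) = law"
  by (rule cdf_unique) (auto simp: law_real_distribution cdf_law eta_cdf intro: real_distribution_distr)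

lemma measure_law_interval: "a \<le> b \<Longrightarrow> measure law {a<..b} = H b - H a"
  using finite_borel_measure.cdf_diff_eq[OF real_distribution.finite_borel_measure_M[OF
      law_real_distribution], of a b]
  by (cases "a = b") (auto simp: cdf_law)

lemma H_mono: "a \<le> b \<Longrightarrow> H a \<le> H b"
  using measure_law_interval[of a b] measure_nonneg[of law "{a<..b}"] by simp

lemma H_measurable [measurable]: "H \<in> borel_measurable borel"
  by (rule borel_measurable_mono) (auto simp: mono_def H_mono)

text \<open>
  The i-th variable is known before \<open>\<eta> n i\<close> is drawn.
\<close>

definition predictable :: "nat \<Rightarrow> (nat \<Rightarrow> 'a \<Rightarrow> real) \<Rightarrow> bool" where
  "predictable n c \<longleftrightarrow> (\<forall>i j. 1 \<le> i \<longrightarrow> i \<le> j \<longrightarrow> j \<le> n \<longrightarrow> c i \<in> borel_measurable (\<A> n j))"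

definition bracket_sum ::
  "nat \<Rightarrow> (nat \<Rightarrow> 'a \<Rightarrow> real) \<Rightarrow> (nat \<Rightarrow> 'a \<Rightarrow> real) \<Rightarrow> (nat \<Rightarrow> 'a \<Rightarrow> real) \<Rightarrow> nat \<Rightarrow> 'a \<Rightarrow> real" where
  "bracket_sum n c a b j \<omega> =
     (\<Sum>i=1..j. c i \<omega> * (of_bool (\<eta> n i \<omega> \<in> {a i \<omega><..b i \<omega>}) - (H (b i \<omega>) - H (a i \<omega>))))"

lemma predictableD: "predictable n c \<Longrightarrow> 1 \<le> i \<Longrightarrow> i \<le> j \<Longrightarrow> j \<le> n \<Longrightarrow> c i \<in> borel_measurable (\<A> n j)"
  by (simp add: predictable_def)

lemma predictable_measurable: "predictable n c \<Longrightarrow> 1 \<le> i \<Longrightarrow> i \<le> n \<Longrightarrow> c i \<in> borel_measurable M"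
  using predictableD[of n c i i] sub_sigma_field[of n i] measurable_from_subalg by auto

lemma bracket_sum_borel_measurable:
  assumes "\<And>i. i \<in> {1..j} \<Longrightarrow> \<eta> n i \<in> borel_measurable N \<and> c i \<in> borel_measurable N \<and>
      a i \<in> borel_measurable N \<and> b i \<in> borel_measurable N"
  shows "bracket_sum n c a b j \<in> borel_measurable N"
  unfolding bracket_sum_def[abs_def]
proof (rule borel_measurable_sum)
  fix i assume "i \<in> {1..j}"
  then have [measurable]: "\<eta> n i \<in> borel_measurable N" "c i \<in> borel_measurable N"
      "a i \<in> borel_measurable N" "b i \<in> borel_measurable N"
    using assms by auto
  show "(\<lambda>\<omega>. c i \<omega> * (of_bool (\<eta> n i \<omega> \<in> {a i \<omega><..b i \<omega>}) - (H (b i \<omega>) - H (a i \<omega>)))) \<in> borel_measurable N"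
    unfolding greaterThanAtMost_iff by measurable
qed

lemma bracket_sum_adapted:
  assumes "predictable n c" "predictable n a" "predictable n b" "j < k" "k \<le> n"
  shows "bracket_sum n c a b j \<in> borel_measurable (\<A> n k)"
  using assms eta_adapted by (intro bracket_sum_borel_measurable) (auto intro!: predictableD)

lemma bracket_sum_measurable:
  assumes "predictable n c" "predictable n a" "predictable n b" "j \<le> n"
  shows "bracket_sum n c a b j \<in> borel_measurable M"
  using assms by (intro bracket_sum_borel_measurable) (auto intro!: predictable_measurable eta_measurable)

text \<open>
  A function \<open>\<phi>\<close> of the two increments and of the remaining budget whose mean does
  not increase in one step of weight k has, after n steps, a mean of at most \<open>\<phi> 0 0
  K\<close>. The step condition is purely algebraic because, given the past, the new term takes one
  of three values: \<open>\<eta> n i\<close> falls into the first interval, into the second, or into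
  neither.
\<close>

lemma potential_supermartingale:
  fixes \<phi> :: "real \<Rightarrow> real \<Rightarrow> real \<Rightarrow> real"
  assumes pred: "predictable n c" "predictable n a" "predictable n b" "predictable n e"
    and ord: "\<And>i \<omega>. \<omega> \<in> space M \<Longrightarrow> 1 \<le> i \<Longrightarrow> i \<le> n \<Longrightarrow> c i \<omega> \<noteq> 0 \<Longrightarrow> 
        a i \<omega> \<le> b i \<omega> \<and> b i \<omega> \<le> e i \<omega> \<and> H (b i \<omega>) - H (a i \<omega>) \<le> P \<and> H (e i \<omega>) - H (b i \<omega>) \<le> Q"
    and budget: "\<And>\<omega>. \<omega> \<in> space M \<Longrightarrow> (\<Sum>i=1..n. (c i \<omega>)\<^sup>2) \<le> K"
    and cap: "\<And>i \<omega>. \<omega> \<in> space M \<Longrightarrow> 1 \<le> i \<Longrightarrow> i \<le> n \<Longrightarrow> (c i \<omega>)\<^sup>2 \<le> L\<^sup>2"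
    and meas[measurable]: "(\<lambda>(x, y, r). \<phi> x y r) \<in> borel_measurable borel"
    and nonneg: "\<And>x y r. 0 \<le> r \<Longrightarrow> 0 \<le> \<phi> x y r"
    and step: "\<And>k p q D E R. 0 \<le> p \<Longrightarrow> p \<le> P \<Longrightarrow> 0 \<le> q \<Longrightarrow> q \<le> Q \<Longrightarrow> p + q \<le> 1 \<Longrightarrow> k\<^sup>2 \<le> R \<Longrightarrow> k\<^sup>2 \<le> L\<^sup>2 \<Longrightarrow>
        p * \<phi> (D + k * (1 - p)) (E - k * q) (R - k\<^sup>2) + q * \<phi> (D - k * p) (E + k * (1 - q)) (R - k\<^sup>2)
         + (1 - p - q) * \<phi> (D - k * p) (E - k * q) (R - k\<^sup>2) \<le> \<phi> D E R"
  shows "(\<integral>\<^sup>+\<omega>. ennreal (\<phi> (bracket_sum n c a b n \<omega>) (bracket_sum n c b e n \<omega>) (K - (\<Sum>i=1..n. (c i \<omega>)\<^sup>2))) \<partial>M)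
    \<le> ennreal (\<phi> 0 0 K)"
proof -
  define \<Phi> where "\<Phi> j \<omega> = \<phi> (bracket_sum n c a b j \<omega>) (bracket_sum n c b e j \<omega>) (K - (\<Sum>i=1..j. (c i
      \<omega>)\<^sup>2))" for j \<omega>
  interpret L: real_distribution law by (rule law_real_distribution)
  have *: "(\<integral>\<^sup>+\<omega>. ennreal (\<Phi> j \<omega>) \<partial>M) \<le> ennreal (\<phi> 0 0 K)" if "j \<le> n" for j
    using that
  proof (induction j)
    case 0
    then show ?case by (simp add: \<Phi>_def bracket_sum_def emeasure_space_1)
  next
    case (Suc j)
    define i where "i = Suc j"
    have i: "1 \<le> i" "i \<le> n" "1 \<le> n" using Suc by (auto simp: i_def)
    define D where "D = bracket_sum n c a b j"
    define E where "E = bracket_sum n c b e j"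
    define R where "R \<omega> = K - (\<Sum>i=1..j. (c i \<omega>)\<^sup>2)" for \<omega>
    define p where "p \<omega> = H (b i \<omega>) - H (a i \<omega>)" for \<omega>
    define q where "q \<omega> = H (e i \<omega>) - H (b i \<omega>)" for \<omega>
    define F where "F \<omega> u v = \<phi> (D \<omega> + c i \<omega> * (u - p \<omega>)) (E \<omega> + c i \<omega> * (v - q \<omega>)) (R \<omega> - (c i
        \<omega>)\<^sup>2)" for \<omega> u v
    have [measurable]: "D \<in> borel_measurable (\<A> n i)" "E \<in> borel_measurable (\<A> n i)"
      unfolding D_def E_def by (auto intro!: bracket_sum_adapted pred i simp: i_def Suc_le_eq)
         (use Suc in auto)
    have cab[measurable]: "c i \<in> borel_measurable (\<A> n i)" "a i \<in> borel_measurable (\<A> n i)"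
       "b i \<in> borel_measurable (\<A> n i)" "e i \<in> borel_measurable (\<A> n i)"
      using i by (auto intro: predictableD pred)
    have [measurable]: "R \<in> borel_measurable (\<A> n i)"
      unfolding R_def[abs_def] by (intro borel_measurable_diff borel_measurable_sum
          borel_measurable_power borel_measurable_const)
         (use i in \<open>auto simp: i_def intro!: predictableD[OF pred(1)]\<close>)
    have [measurable]: "p \<in> borel_measurable (\<A> n i)" "q \<in> borel_measurable (\<A> n i)"
      unfolding p_def[abs_def] q_def[abs_def] by measurable
    have \<phi>3: "(\<lambda>z. \<phi> (f z) (g z) (r z)) \<in> borel_measurable N"
      if [measurable]: "f \<in> borel_measurable N" "g \<in> borel_measurable N" "r \<in> borel_measurable N"
      for f g r and N :: "'z measure"
    proof -
      have "(\<lambda>z. (\<lambda>(x, y, r). \<phi> x y r) (f z, g z, r z)) \<in> borel_measurable N"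
        by measurable
      then show ?thesis by simp
    qed
    define G where "G z = ennreal (F (fst z) (of_bool (snd z \<in> {a i (fst z)<..b i (fst z)}))
        (of_bool (snd z \<in> {b i (fst z)<..e i (fst z)})))" for z
    have G: "G \<in> borel_measurable (\<A> n i \<Otimes>\<^sub>M borel)"
      unfolding G_def[abs_def] F_def greaterThanAtMost_iff by (intro measurable_compose[OF _
          measurable_ennreal] \<phi>3) measurable
    have G_eq: "ennreal (\<Phi> (Suc j) \<omega>) = G (\<omega>, \<eta> n i \<omega>)" for \<omega>
      unfolding \<Phi>_def G_def F_def D_def E_def R_def p_def q_def i_def
      by (simp add: bracket_sum_def algebra_simps)
    have inner: "(\<integral>\<^sup>+y. G (\<omega>, y) \<partial>law) \<le> ennreal (\<Phi> j \<omega>)" if w: "\<omega> \<in> space M" for \<omega>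
    proof -
      have "(\<Sum>k=1..i. (c k \<omega>)\<^sup>2) \<le> (\<Sum>k=1..n. (c k \<omega>)\<^sup>2)"
        using i by (intro sum_mono2) auto
      then have R: "(c i \<omega>)\<^sup>2 \<le> R \<omega>" using budget[OF w] by (simp add: R_def i_def)
      show ?thesis
      proof (cases "c i \<omega> = 0")
        case True
        then have "G (\<omega>, y) = ennreal (\<Phi> j \<omega>)" for y
          by (simp add: G_def F_def \<Phi>_def D_def E_def R_def)
        then show ?thesis using L.emeasure_space_1 by simp
      next
        case False
        note o = ord[OF w i(1,2) False]
        have m: "measure law {a i \<omega><..b i \<omega>} = p \<omega>" "measure law {b i \<omega><..e i \<omega>} = q \<omega>"
          using o by (auto simp: p_def q_def measure_law_interval)
        have F0: "0 \<le> F \<omega> u v" for u v unfolding F_def using R by (intro nonneg) simp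
        have "(\<integral>\<^sup>+y. G (\<omega>, y) \<partial>law) = ennreal (p \<omega> * F \<omega> 1 0 + q \<omega> * F \<omega> 0 1 + (1 - p \<omega> - q \<omega>) * F \<omega> 0 0)"
          unfolding G_def fst_conv snd_conv
          by (subst L.nn_integral_two_disjoint_events) (use m F0 in auto)
        also have "\<dots> \<le> ennreal (\<Phi> j \<omega>)"
        proof (rule ennreal_leI)
          have pq: "0 \<le> p \<omega>" "p \<omega> \<le> P" "0 \<le> q \<omega>" "q \<omega> \<le> Q"
            using o by (auto simp: p_def q_def H_mono)
          have F_eq: "F \<omega> 1 0 = \<phi> (D \<omega> + c i \<omega> * (1 - p \<omega>)) (E \<omega> - c i \<omega> * q \<omega>) (R \<omega> - (c i \<omega>)\<^sup>2)"
            "F \<omega> 0 1 = \<phi> (D \<omega> - c i \<omega> * p \<omega>) (E \<omega> + c i \<omega> * (1 - q \<omega>)) (R \<omega> - (c i \<omega>)\<^sup>2)"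
            "F \<omega> 0 0 = \<phi> (D \<omega> - c i \<omega> * p \<omega>) (E \<omega> - c i \<omega> * q \<omega>) (R \<omega> - (c i \<omega>)\<^sup>2)"
            by (simp_all add: F_def)
          have \<Phi>_eq: "\<Phi> j \<omega> = \<phi> (D \<omega>) (E \<omega>) (R \<omega>)"
            by (simp add: \<Phi>_def D_def E_def R_def)
          have "p \<omega> + q \<omega> = measure law {a i \<omega><..e i \<omega>}"
            using o by (simp add: p_def q_def measure_law_interval)
          then have "p \<omega> + q \<omega> \<le> 1" by simp
          then show "p \<omega> * F \<omega> 1 0 + q \<omega> * F \<omega> 0 1 + (1 - p \<omega> - q \<omega>) * F \<omega> 0 0 \<le> \<Phi> j \<omega>"
            using step[of "p \<omega>" "q \<omega>" "c i \<omega>" "R \<omega>" "D \<omega>" "E \<omega>"] pq R cap[OF w i(1,2)]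
            unfolding F_eq \<Phi>_eq by blast
        qed
        finally show ?thesis .
      qed
    qed
    have "(\<integral>\<^sup>+\<omega>. ennreal (\<Phi> (Suc j) \<omega>) \<partial>M) = (\<integral>\<^sup>+\<omega>. G (\<omega>, \<eta> n i \<omega>) \<partial>M)"
      by (simp add: G_eq)
    also have "\<dots> = (\<integral>\<^sup>+\<omega>. (\<integral>\<^sup>+y. G (\<omega>, y) \<partial>law) \<partial>M)"
      using nn_integral_independent_coordinate[OF sub_sigma_field[of n i] eta_measurable[of i n]
          eta_indep_past[of i n] G] i
      by (simp add: distr_eta)
    also have "\<dots> \<le> (\<integral>\<^sup>+\<omega>. ennreal (\<Phi> j \<omega>) \<partial>M)"
      by (rule nn_integral_mono) (rule inner)
    also have "\<dots> \<le> ennreal (\<phi> 0 0 K)" using Suc by simp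
    finally show ?case .
  qed
  from *[of n] show ?thesis by (simp add: \<Phi>_def)
qed

lemma budget_nonneg:
  assumes "\<And>\<omega>. \<omega> \<in> space M \<Longrightarrow> (\<Sum>i=1..n. (c i \<omega>)\<^sup>2) \<le> (K::real)"
  shows "0 \<le> K"
proof -
  obtain \<omega> where "\<omega> \<in> space M" using not_empty by auto
  then show ?thesis using assms[of \<omega>] sum_nonneg[of "{1..n}" "\<lambda>i. (c i \<omega>)\<^sup>2"] by fastforce
qed

text \<open>
  Markov's inequality for the product of the squares of the two increments.
\<close>

lemma adjacent_increments_tail:
  assumes pred: "predictable n c" "predictable n a" "predictable n b" "predictable n e"
    and ord: "\<And>i \<omega>. \<omega> \<in> space M \<Longrightarrow> 1 \<le> i \<Longrightarrow> i \<le> n \<Longrightarrow> c i \<omega> \<noteq> 0 \<Longrightarrow>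
        a i \<omega> \<le> b i \<omega> \<and> b i \<omega> \<le> e i \<omega> \<and> H (b i \<omega>) - H (a i \<omega>) \<le> P \<and> H (e i \<omega>) - H (b i \<omega>) \<le> Q"
    and budget: "\<And>\<omega>. \<omega> \<in> space M \<Longrightarrow> (\<Sum>i=1..n. (c i \<omega>)\<^sup>2) \<le> K"
    and PQ: "0 \<le> P" "P \<le> 1" "0 \<le> Q" "Q \<le> 1" and \<beta>: "0 < \<beta>"
  shows "emeasure M {\<omega> \<in> space M. \<beta> < min \<bar>bracket_sum n c a b n \<omega>\<bar> \<bar>bracket_sum n c b e n \<omega>\<bar>}
    \<le> ennreal (11 * K\<^sup>2 * (P * Q) / \<beta> ^ 4)"
proof -
  let ?D = "bracket_sum n c a b n" and ?E = "bracket_sum n c b e n"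
  have [measurable]: "?D \<in> borel_measurable M" "?E \<in> borel_measurable M"
    using pred by (auto intro: bracket_sum_measurable)
  have K0: "0 \<le> K" using budget by (rule budget_nonneg)
  define \<phi> where "\<phi> = (\<lambda>x y r. x\<^sup>2 * y\<^sup>2 + 4 * r * (Q * x\<^sup>2 + P * y\<^sup>2) + 11 * r\<^sup>2 * (P * Q))"
  \<comment> \<open>The budget bounds each squared weight, so sqrt K serves as the cap L.\<close>
  have cap: "(c i \<omega>)\<^sup>2 \<le> (sqrt K)\<^sup>2" if "\<omega> \<in> space M" "1 \<le> i" "i \<le> n" for i \<omega>
    using member_le_sum[of i "{1..n}" "\<lambda>i. (c i \<omega>)\<^sup>2"] budget[of \<omega>] that K0 by simp
  have \<phi>: "(\<integral>\<^sup>+\<omega>. ennreal (\<phi> (?D \<omega>) (?E \<omega>) (K - (\<Sum>i=1..n. (c i \<omega>)\<^sup>2))) \<partial>M) \<le> ennreal (\<phi> 0 0 K)"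
  proof (rule potential_supermartingale[OF pred ord budget cap])
    show "(\<lambda>(x, y, r). \<phi> x y r) \<in> borel_measurable borel"
      unfolding \<phi>_def by (subst borel_prod[symmetric], subst borel_prod[symmetric]) measurable
    show "0 \<le> r \<Longrightarrow> 0 \<le> \<phi> x y r" for x y r unfolding \<phi>_def using PQ by simp
    show "p * \<phi> (D + k * (1 - p)) (E - k * q) (R - k\<^sup>2) + q * \<phi> (D - k * p) (E + k * (1 - q)) (R - k\<^sup>2)
         + (1 - p - q) * \<phi> (D - k * p) (E - k * q) (R - k\<^sup>2) \<le> \<phi> D E R"
      if "0 \<le> p" "p \<le> P" "0 \<le> q" "q \<le> Q" "p + q \<le> 1" "k\<^sup>2 \<le> R" "k\<^sup>2 \<le> (sqrt K)\<^sup>2" for k p q D E R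
      unfolding \<phi>_def using that PQ by (intro product_potential_step) auto
  qed auto
  have "emeasure M {\<omega> \<in> space M. \<beta> < min \<bar>?D \<omega>\<bar> \<bar>?E \<omega>\<bar>}
     \<le> emeasure M {\<omega> \<in> space M. 1 \<le> ennreal (1 / \<beta> ^ 4) * ennreal ((?D \<omega>)\<^sup>2 * (?E \<omega>)\<^sup>2)}"
  proof (rule emeasure_mono)
    show "{\<omega> \<in> space M. \<beta> < min \<bar>?D \<omega>\<bar> \<bar>?E \<omega>\<bar>}
      \<subseteq> {\<omega> \<in> space M. 1 \<le> ennreal (1 / \<beta> ^ 4) * ennreal ((?D \<omega>)\<^sup>2 * (?E \<omega>)\<^sup>2)}"
    proof safe
      fix \<omega> assume "\<beta> < min \<bar>?D \<omega>\<bar> \<bar>?E \<omega>\<bar>"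
      then have "\<beta>\<^sup>2 \<le> (?D \<omega>)\<^sup>2" "\<beta>\<^sup>2 \<le> (?E \<omega>)\<^sup>2"
        using \<beta> by (auto simp: abs_le_square_iff[symmetric])
      then have "\<beta>\<^sup>2 * \<beta>\<^sup>2 \<le> (?D \<omega>)\<^sup>2 * (?E \<omega>)\<^sup>2" by (intro mult_mono) auto
      then have "1 \<le> 1 / \<beta> ^ 4 * ((?D \<omega>)\<^sup>2 * (?E \<omega>)\<^sup>2)"
        using \<beta> by (simp add: field_simps flip: power_add)
      then show "1 \<le> ennreal (1 / \<beta> ^ 4) * ennreal ((?D \<omega>)\<^sup>2 * (?E \<omega>)\<^sup>2)"
        using \<beta> by (simp flip: ennreal_mult)
    qed
  qed measurable
  also have "\<dots> \<le> ennreal (1 / \<beta> ^ 4) * (\<integral>\<^sup>+\<omega>\<in>space M. ennreal ((?D \<omega>)\<^sup>2 * (?E \<omega>)\<^sup>2) \<partial>M)"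
    by (rule order_trans[OF _ nn_integral_Markov_inequality]) (auto intro!: emeasure_mono)
  also have "(\<integral>\<^sup>+\<omega>\<in>space M. ennreal ((?D \<omega>)\<^sup>2 * (?E \<omega>)\<^sup>2) \<partial>M)
      \<le> (\<integral>\<^sup>+\<omega>. ennreal (\<phi> (?D \<omega>) (?E \<omega>) (K - (\<Sum>i=1..n. (c i \<omega>)\<^sup>2))) \<partial>M)"
    using budget PQ by (intro nn_integral_mono) (auto simp: \<phi>_def indicator_def intro!: ennreal_leI
        mult_nonneg_nonneg add_nonneg_nonneg)
  also note \<phi>
  also have "ennreal (1 / \<beta> ^ 4) * ennreal (\<phi> 0 0 K) = ennreal (11 * K\<^sup>2 * (P * Q) / \<beta> ^ 4)"
    using \<beta> PQ by (simp add: \<phi>_def flip: ennreal_mult)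
  finally show ?thesis by (simp add: mult_left_mono)
qed

text \<open>
  Markov's inequality for the fourth power, with an empty second interval in the potential.
\<close>

lemma single_increment_tail:
  assumes pred: "predictable n c" "predictable n a" "predictable n b"
    and ord: "\<And>i \<omega>. \<omega> \<in> space M \<Longrightarrow> 1 \<le> i \<Longrightarrow> i \<le> n \<Longrightarrow> c i \<omega> \<noteq> 0 \<Longrightarrow>
        a i \<omega> \<le> b i \<omega> \<and> H (b i \<omega>) - H (a i \<omega>) \<le> P"
    and budget: "\<And>\<omega>. \<omega> \<in> space M \<Longrightarrow> (\<Sum>i=1..n. (c i \<omega>)\<^sup>2) \<le> K"
    and cap: "\<And>i \<omega>. \<omega> \<in> space M \<Longrightarrow> 1 \<le> i \<Longrightarrow> i \<le> n \<Longrightarrow> (c i \<omega>)\<^sup>2 \<le> L\<^sup>2"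
    and P: "0 \<le> P" and \<beta>: "0 < \<beta>"
  shows "emeasure M {\<omega> \<in> space M. \<beta> < \<bar>bracket_sum n c a b n \<omega>\<bar>}
    \<le> ennreal ((8 * K\<^sup>2 * P\<^sup>2 + 3 * L\<^sup>2 * K * P) / \<beta> ^ 4)"
proof -
  let ?D = "bracket_sum n c a b n"
  have [measurable]: "?D \<in> borel_measurable M"
    using pred by (auto intro: bracket_sum_measurable)
  have K0: "0 \<le> K" using budget by (rule budget_nonneg)
  define \<phi> where "\<phi> = (\<lambda>x (y::real) r. x ^ 4 + 8 * r * (P * x\<^sup>2) + 8 * r\<^sup>2 * P\<^sup>2 + 3 * L\<^sup>2 * r * P)"
  have \<phi>: "(\<integral>\<^sup>+\<omega>. ennreal (\<phi> (?D \<omega>) (bracket_sum n c b b n \<omega>) (K - (\<Sum>i=1..n. (c i \<omega>)\<^sup>2))) \<partial>M)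
     \<le> ennreal (\<phi> 0 0 K)"
  proof (rule potential_supermartingale[OF pred(1,2,3,3) _ budget cap, where P = P and Q = 0])
    show "(\<lambda>(x, y, r). \<phi> x y r) \<in> borel_measurable borel"
      unfolding \<phi>_def by (subst borel_prod[symmetric], subst borel_prod[symmetric]) measurable
    show "0 \<le> r \<Longrightarrow> 0 \<le> \<phi> x y r" for x y r unfolding \<phi>_def using P by simp
    show "p * \<phi> (D + k * (1 - p)) (E - k * q) (R - k\<^sup>2) + q * \<phi> (D - k * p) (E + k * (1 - q)) (R - k\<^sup>2)
         + (1 - p - q) * \<phi> (D - k * p) (E - k * q) (R - k\<^sup>2) \<le> \<phi> D E R"
      if "0 \<le> p" "p \<le> P" "0 \<le> q" "q \<le> 0" "p + q \<le> 1" "k\<^sup>2 \<le> R" "k\<^sup>2 \<le> L\<^sup>2" for k p q D E R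
      using fourth_power_potential_step[of p P k R L D] that unfolding \<phi>_def by simp
  qed (use ord in auto)
  have "emeasure M {\<omega> \<in> space M. \<beta> < \<bar>?D \<omega>\<bar>}
     \<le> emeasure M {\<omega> \<in> space M. 1 \<le> ennreal (1 / \<beta> ^ 4) * ennreal ((?D \<omega>) ^ 4)}"
  proof (rule emeasure_mono)
    show "{\<omega> \<in> space M. \<beta> < \<bar>?D \<omega>\<bar>} \<subseteq> {\<omega> \<in> space M. 1 \<le> ennreal (1 / \<beta> ^ 4) * ennreal ((?D \<omega>) ^ 4)}"
    proof safe
      fix \<omega> assume "\<beta> < \<bar>?D \<omega>\<bar>"
      then have "\<beta> ^ 4 \<le> \<bar>?D \<omega>\<bar> ^ 4"
        using \<beta> by (intro power_mono) auto
      then have "1 \<le> 1 / \<beta> ^ 4 * (?D \<omega>) ^ 4"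
        using \<beta> by (simp add: field_simps power_even_abs)
      then show "1 \<le> ennreal (1 / \<beta> ^ 4) * ennreal ((?D \<omega>) ^ 4)"
        using \<beta> by (simp flip: ennreal_mult)
    qed
  qed measurable
  also have "\<dots> \<le> ennreal (1 / \<beta> ^ 4) * (\<integral>\<^sup>+\<omega>\<in>space M. ennreal ((?D \<omega>) ^ 4) \<partial>M)"
    by (rule order_trans[OF _ nn_integral_Markov_inequality]) (auto intro!: emeasure_mono)
  also have "(\<integral>\<^sup>+\<omega>\<in>space M. ennreal ((?D \<omega>) ^ 4) \<partial>M)
      \<le> (\<integral>\<^sup>+\<omega>. ennreal (\<phi> (?D \<omega>) (bracket_sum n c b b n \<omega>) (K - (\<Sum>i=1..n. (c i \<omega>)\<^sup>2))) \<partial>M)"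
    using budget P by (intro nn_integral_mono) (auto simp: \<phi>_def indicator_def intro!: ennreal_leI
        mult_nonneg_nonneg add_nonneg_nonneg)
  also note \<phi>
  also have "ennreal (1 / \<beta> ^ 4) * ennreal (\<phi> 0 0 K) = ennreal ((8 * K\<^sup>2 * P\<^sup>2 + 3 * L\<^sup>2 * K * P) / \<beta> ^ 4)"
    using \<beta> P K0 by (subst ennreal_mult[symmetric]) (simp_all add: \<phi>_def)
  finally show ?thesis by (simp add: mult_left_mono)
qed

end

section \<open>Oscillation of the shifted empirical process over one cell\<close>

context weighted_array begin

text \<open>
  With weights \<open>\<gamma> n i / sqrt n\<close> this is \<open>U_tilde\<close>; with T = Z = 0
  it is \<open>U_star\<close>. The arguments of H stay in the form used there.
\<close>

definition shifted_sum ::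
  "nat \<Rightarrow> (nat \<Rightarrow> 'a \<Rightarrow> real) \<Rightarrow> (nat \<Rightarrow> 'a \<Rightarrow> real) \<Rightarrow> (nat \<Rightarrow> 'a \<Rightarrow> real) \<Rightarrow> real \<Rightarrow> 'a \<Rightarrow> real" where
  "shifted_sum n c T Z t \<omega> =
     (\<Sum>i=1..n. c i \<omega> * (of_bool (\<eta> n i \<omega> \<le> t + t * T i \<omega> + Z i \<omega>) - H (t + t * T i \<omega> + Z i \<omega>)))"

abbreviation shift :: "(nat \<Rightarrow> 'a \<Rightarrow> real) \<Rightarrow> (nat \<Rightarrow> 'a \<Rightarrow> real) \<Rightarrow> real \<Rightarrow> nat \<Rightarrow> 'a \<Rightarrow> real" where
  "shift T Z t \<equiv> \<lambda>i \<omega>. t + t * T i \<omega> + Z i \<omega>"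

lemma shift_mono:
  assumes "s \<le> t" "-1 \<le> T i \<omega>"
  shows "shift T Z s i \<omega> \<le> shift T Z t i \<omega>"
proof -
  have "s * (1 + T i \<omega>) \<le> t * (1 + T i \<omega>)" using assms by (intro mult_right_mono) auto
  then show ?thesis by (simp add: algebra_simps)
qed

lemma predictable_shift:
  assumes "predictable n T" "predictable n Z"
  shows "predictable n (shift T Z t)"
  unfolding predictable_def
proof (intro allI impI)
  fix i j assume "1 \<le> i" "i \<le> j" "j \<le> n"
  then have [measurable]: "T i \<in> borel_measurable (\<A> n j)" "Z i \<in> borel_measurable (\<A> n j)"
    using assms by (auto intro: predictableD)
  show "shift T Z t i \<in> borel_measurable (\<A> n j)" by measurable
qed

lemma shifted_sum_increment:
  assumes "s \<le> t" "\<And>i. 1 \<le> i \<Longrightarrow> i \<le> n \<Longrightarrow> c i \<omega> \<noteq> 0 \<Longrightarrow> -1 \<le> T i \<omega>"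
  shows "shifted_sum n c T Z t \<omega> - shifted_sum n c T Z s \<omega> = bracket_sum n c (shift T Z s) (shift T Z t) n \<omega>"
  unfolding shifted_sum_def bracket_sum_def sum_subtractf[symmetric]
proof (rule sum.cong[OF refl])
  fix i assume i: "i \<in> {1..n}"
  show "c i \<omega> * (of_bool (\<eta> n i \<omega> \<le> shift T Z t i \<omega>) - H (shift T Z t i \<omega>)) -
         c i \<omega> * (of_bool (\<eta> n i \<omega> \<le> shift T Z s i \<omega>) - H (shift T Z s i \<omega>)) =
         c i \<omega> * (of_bool (\<eta> n i \<omega> \<in> {shift T Z s i \<omega><..shift T Z t i \<omega>}) -
          (H (shift T Z t i \<omega>) - H (shift T Z s i \<omega>)))"
  proof (cases "c i \<omega> = 0")
    case False
    then have "shift T Z s i \<omega> \<le> shift T Z t i \<omega>" using assms i by (intro shift_mono) auto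
    then have eq: "of_bool (\<eta> n i \<omega> \<in> {shift T Z s i \<omega><..shift T Z t i \<omega>})
      = (of_bool (\<eta> n i \<omega> \<le> shift T Z t i \<omega>) - of_bool (\<eta> n i \<omega> \<le> shift T Z s i \<omega>) :: real)"
      by auto
    show ?thesis unfolding eq by algebra
  qed simp
qed

end

text \<open>
  What the proof uses of the density: boundedness makes H Lipschitz, and the first moment is finite.
\<close>

locale lipschitz_moment_array = weighted_array +
  fixes C \<mu> :: real
  assumes C_pos: "0 < C"
    and H_lipschitz: "\<And>a b. a \<le> b \<Longrightarrow> H b - H a \<le> C * (b - a)"
    and moment: "(\<integral>\<^sup>+y. ennreal (1 + \<bar>y\<bar>) \<partial>law) \<le> ennreal \<mu>"
begin

lemma H_continuous: "continuous (at x) H"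
proof -
  have le: "\<bar>H y - H x\<bar> \<le> C * \<bar>y - x\<bar>" for y
    using H_lipschitz[of x y] H_lipschitz[of y x] H_mono[of x y] H_mono[of y x]
    by (cases "x \<le> y") (auto simp: abs_if)
  have "((\<lambda>y. C * \<bar>y - x\<bar>) \<longlongrightarrow> C * \<bar>x - x\<bar>) (at x)" by (intro tendsto_intros)
  then have lim: "((\<lambda>y. C * \<bar>y - x\<bar>) \<longlongrightarrow> 0) (at x)" by simp
  have "((\<lambda>y. H y - H x) \<longlongrightarrow> 0) (at x)"
    by (rule Lim_null_comparison[OF always_eventually lim]) (use le in simp)
  then show ?thesis unfolding continuous_within by (rule LIM_zero_cancel)
qed

lemma shifted_sum_right_continuous:
  assumes T: "\<And>i. 1 \<le> i \<Longrightarrow> i \<le> n \<Longrightarrow> c i \<omega> \<noteq> 0 \<Longrightarrow> -1 < T i \<omega>"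
  shows "continuous (at_right t) (\<lambda>t. shifted_sum n c T Z t \<omega>)"
  unfolding shifted_sum_def
proof (rule continuous_sum)
  fix i assume i: "i \<in> {1..n}"
  let ?s = "\<lambda>t. shift T Z t i \<omega>"
  show "continuous (at_right t) (\<lambda>t. c i \<omega> * (of_bool (\<eta> n i \<omega> \<le> ?s t) - H (?s t)))"
  proof (cases "c i \<omega> = 0")
    case True
    show ?thesis unfolding True mult_zero_left by (rule continuous_const)
  next
    case False
    then have T': "-1 < T i \<omega>" using T i by auto
    have s: "(?s \<longlongrightarrow> ?s t) (at_right t)" by (intro tendsto_intros)
    have Hs: "((\<lambda>t. H (?s t)) \<longlongrightarrow> H (?s t)) (at_right t)"
      by (rule isCont_tendsto_compose[OF H_continuous s])
    have "\<forall>\<^sub>F y in at_right t. of_bool (\<eta> n i \<omega> \<le> ?s y) = (of_bool (\<eta> n i \<omega> \<le> ?s t) :: real)"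
    proof (cases "\<eta> n i \<omega> \<le> ?s t")
      case True
      have "\<eta> n i \<omega> \<le> ?s y" if "t < y" for y
        using shift_mono[of t y T i \<omega> Z] that T' True by linarith
      then show ?thesis using True by (auto simp: eventually_at_filter)
    next
      case False
      then have "\<forall>\<^sub>F y in at_right t. ?s y < \<eta> n i \<omega>" using s by (intro order_tendstoD(2)) auto
      then show ?thesis by eventually_elim (use False in auto)
    qed
    then have Is: "((\<lambda>y. of_bool (\<eta> n i \<omega> \<le> ?s y) :: real) \<longlongrightarrow> of_bool (\<eta> n i \<omega> \<le> ?s t)) (at_right t)"
      by (rule tendsto_eventually)
    show ?thesis
      unfolding continuous_within by (rule tendsto_mult[OF tendsto_const tendsto_diff[OF Is Hs]])
  qed
qed

text \<open>
  All values at which the indicators are evaluated while t runs through the cell [k/m, (k+1)/m] lie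
  here, if the shifts are at most 1/m. The radius grows linearly in k/m because the scale
  perturbation t T is proportional to t.
\<close>

definition window :: "nat \<Rightarrow> int \<Rightarrow> real set" where
  "window m k = {y. \<bar>y - of_int k / real m\<bar> \<le> 3 * (1 + \<bar>of_int k / real m\<bar>) / real m}"

lemma window_borel [measurable]: "window m k \<in> sets borel"
  unfolding window_def by measurable

lemma shift_in_window:
  assumes m: "1 \<le> m" and small: "\<bar>T i \<omega>\<bar> \<le> 1 / real m" "\<bar>Z i \<omega>\<bar> \<le> 1 / real m"
    and t: "of_int k / real m \<le> t" "t \<le> of_int k / real m + 1 / real m"
  shows "shift T Z t i \<omega> \<in> window m k"
proof -
  define x where "x = of_int k / real m"
  define d where "d = 1 / real m"
  have d: "0 < d" "d \<le> 1" using m by (auto simp: d_def)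
  have t: "x \<le> t" "t \<le> x + d" using t by (auto simp: x_def d_def)
  have "\<bar>t * T i \<omega>\<bar> \<le> (\<bar>x\<bar> + d) * d"
    unfolding abs_mult using t small d by (intro mult_mono) (auto simp: d_def)
  also have "\<dots> \<le> \<bar>x\<bar> * d + d" using mult_left_mono[of d 1 d] d by (simp add: algebra_simps)
  finally have "\<bar>shift T Z t i \<omega> - x\<bar> \<le> d + (\<bar>x\<bar> * d + d) + d"
    using t small unfolding d_def by linarith
  also have "\<dots> \<le> 3 * (1 + \<bar>x\<bar>) * d" using d by (simp add: algebra_simps)
  finally show ?thesis by (simp add: window_def x_def d_def)
qed

text \<open>
  The chaining bound controls, at each dyadic t, the smaller of the distances of X(t) to the values
  at the two ends of the cell; a bound on the increment over the whole cell turns this into a bound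
  on the distance to the left end. Right-continuity passes from dyadic t to all t.
\<close>

lemma cell_oscillation:
  fixes k :: int and m n :: nat and K L \<epsilon> :: real
  defines "x \<equiv> of_int k / real m"
  assumes pred: "predictable n c" "predictable n T" "predictable n Z"
    and m: "2 \<le> m"
    and small: "\<And>i \<omega>. \<omega> \<in> space M \<Longrightarrow> 1 \<le> i \<Longrightarrow> i \<le> n \<Longrightarrow> c i \<omega> \<noteq> 0 \<Longrightarrow>
        \<bar>T i \<omega>\<bar> \<le> 1 / real m \<and> \<bar>Z i \<omega>\<bar> \<le> 1 / real m"
    and budget: "\<And>\<omega>. \<omega> \<in> space M \<Longrightarrow> (\<Sum>i=1..n. (c i \<omega>)\<^sup>2) \<le> K"
    and cap: "\<And>i \<omega>. \<omega> \<in> space M \<Longrightarrow> 1 \<le> i \<Longrightarrow> i \<le> n \<Longrightarrow> (c i \<omega>)\<^sup>2 \<le> L\<^sup>2"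
    and \<epsilon>: "0 < \<epsilon>"
  defines "P \<equiv> measure law (window m k)"
  shows "\<exists>B\<in>sets M. emeasure M B \<le> ennreal ((35200000 * K\<^sup>2 * (C / m * P) + 8 * K\<^sup>2 * P\<^sup>2 + 3 * L\<^sup>2
      * K * P) / \<epsilon> ^ 4) \<and>
    (\<forall>\<omega>\<in>space M - B. \<forall>t. x \<le> t \<longrightarrow> t \<le> x + 1 / real m \<longrightarrow>
        \<bar>shifted_sum n c T Z t \<omega> - shifted_sum n c T Z x \<omega>\<bar> \<le> 2 * \<epsilon>)"
proof -
  interpret L: real_distribution law by (rule law_real_distribution)
  define l where "l = 1 / real m"
  have l: "0 < l" "l \<le> 1/2" using m by (auto simp: l_def)
  have K0: "0 \<le> K" using budget by (rule budget_nonneg)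
  have P01: "0 \<le> P" "P \<le> 1" by (auto simp: P_def)
  define A where "A = C * l"
  have A: "0 < A" using C_pos l by (simp add: A_def)
  obtain \<beta> :: "nat \<Rightarrow> real" where \<beta>0: "\<And>j. 0 < \<beta> j" and \<beta>1: "\<And>J. (\<Sum>j<J. \<beta> j) \<le> 1"
    and \<beta>2: "\<And>J. (\<Sum>j<J. 2 ^ j * (min (A / 2 ^ j) P)\<^sup>2 / \<beta> j ^ 4) \<le> 3200000 * (A * P)"
    by (rule chaining_thresholds[OF A P01(1)]) (rule that)
  let ?u = "shift T Z"
  have T1: "-1 < T i \<omega>" "-1 \<le> T i \<omega>" "T i \<omega> \<le> 1" if "\<omega> \<in> space M" "1 \<le> i" "i \<le> n" "c i \<omega> \<noteq> 0" for i \<omega>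
    using small[OF that] l unfolding l_def by linarith+
  have inc: "?u s i \<omega> \<le> ?u t i \<omega> \<and> H (?u t i \<omega>) - H (?u s i \<omega>) \<le> min (2 * C * (t - s)) P"
    if w: "\<omega> \<in> space M" "1 \<le> i" "i \<le> n" "c i \<omega> \<noteq> 0" and st: "x \<le> s" "s \<le> t" "t \<le> x + l" for i \<omega> s t
  proof -
    have le: "?u s i \<omega> \<le> ?u t i \<omega>" using T1[OF w] st by (intro shift_mono) auto
    have "H (?u t i \<omega>) - H (?u s i \<omega>) \<le> C * (?u t i \<omega> - ?u s i \<omega>)" by (rule H_lipschitz[OF le])
    also have "\<dots> = C * ((t - s) * (1 + T i \<omega>))" by (simp add: algebra_simps)
    also have "\<dots> \<le> C * ((t - s) * 2)"
      using C_pos st T1[OF w] by (intro mult_left_mono) auto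
    finally have 1: "H (?u t i \<omega>) - H (?u s i \<omega>) \<le> 2 * C * (t - s)" by (simp add: algebra_simps)
    have win: "?u s i \<omega> \<in> window m k" "?u t i \<omega> \<in> window m k"
      using small[OF w] st m by (auto intro!: shift_in_window simp: x_def l_def)
    have "{?u s i \<omega><..?u t i \<omega>} \<subseteq> window m k"
      using win unfolding window_def by auto
    then have "H (?u t i \<omega>) - H (?u s i \<omega>) \<le> P"
      unfolding P_def measure_law_interval[OF le, symmetric] by (intro L.finite_measure_mono) auto
    with 1 le show ?thesis by simp
  qed
  define d where "d = dyadic x l"
  have d_le: "x \<le> d j i" "d j i \<le> x + l" if "i \<le> 2 ^ j" for i j
  proof -
    have "real i / 2 ^ j \<le> 1" using that by (simp add: divide_le_eq_1)
    then have "l * (real i / 2 ^ j) \<le> l * 1" using l by (intro mult_left_mono) auto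
    then show "x \<le> d j i" "d j i \<le> x + l" using l by (auto simp: d_def dyadic_def)
  qed
  \<comment> \<open>The i-th interval of level j and its midpoint; the chaining bound holds off all these events.\<close>
  define Bad where "Bad j i = {\<omega> \<in> space M. \<epsilon> * \<beta> j <
      min \<bar>bracket_sum n c (?u (d j i)) (?u (d (Suc j) (2 * i + 1))) n \<omega>\<bar>
          \<bar>bracket_sum n c (?u (d (Suc j) (2 * i + 1))) (?u (d j (Suc i))) n \<omega>\<bar>}" for j i
  define B1 where "B1 = (\<Union>j. \<Union>i<2 ^ j. Bad j i)"
  define B2 where "B2 = {\<omega> \<in> space M. \<epsilon> < \<bar>bracket_sum n c (?u x) (?u (x + l)) n \<omega>\<bar>}"
  note bm = bracket_sum_measurable[OF pred(1) predictable_shift[OF pred(2,3)] predictable_shift[OF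
      pred(2,3)] order_refl]
  have Bad_sets: "Bad j i \<in> sets M" for j i
    unfolding Bad_def using bm by measurable
  have sets: "B1 \<in> sets M" "B2 \<in> sets M"
    unfolding B1_def B2_def using Bad_sets bm by measurable
  have diffs: "d (Suc j) (2 * i + 1) - d j i = l / 2 ^ Suc j" "d j (Suc i) - d (Suc j) (2 * i + 1) =
      l / 2 ^ Suc j" for i j
    by (simp_all add: d_def dyadic_def field_simps)
  have dd: "d j i \<le> d (Suc j) (2 * i + 1)" "d (Suc j) (2 * i + 1) \<le> d j (Suc i)" for i j
  proof -
    have "0 \<le> l / 2 ^ Suc j" using l by simp
    then show "d j i \<le> d (Suc j) (2 * i + 1)" "d (Suc j) (2 * i + 1) \<le> d j (Suc i)"
      using diffs[of j i] by linarith+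
  qed
  have Bad_le: "emeasure M (Bad j i) \<le> ennreal (11 * K\<^sup>2 * (min (A / 2 ^ j) P * min (A / 2 ^ j) P) /
      (\<epsilon> * \<beta> j) ^ 4)"
    if i: "i < 2 ^ j" for j i
    unfolding Bad_def
  proof (rule adjacent_increments_tail[OF pred(1) predictable_shift[OF pred(2,3)]
      predictable_shift[OF pred(2,3)] predictable_shift[OF pred(2,3)] _ budget])
    fix \<omega> i' assume w: "\<omega> \<in> space M" "1 \<le> i'" "i' \<le> n" "c i' \<omega> \<noteq> 0"
    have le: "x \<le> d j i" "d j i \<le> d (Suc j) (2 * i + 1)" "d (Suc j) (2 * i + 1) \<le> d j (Suc i)" "d j
        (Suc i) \<le> x + l"
      using d_le[of i j] d_le[of "Suc i" j] dd[of j i] i by (auto simp: Suc_le_eq intro: order_less_imp_le)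
    \<comment> \<open>The factor 2 from the slope 1 + T i of the shift is compensated by the halving of the interval.\<close>
    have "2 * C * (l / 2 ^ Suc j) = A / 2 ^ j" by (simp add: A_def)
    then show "?u (d j i) i' \<omega> \<le> ?u (d (Suc j) (2 * i + 1)) i' \<omega> \<and> ?u (d (Suc j) (2 * i + 1)) i' \<omega> \<le>
        ?u (d j (Suc i)) i' \<omega> \<and>
       H (?u (d (Suc j) (2 * i + 1)) i' \<omega>) - H (?u (d j i) i' \<omega>) \<le> min (A / 2 ^ j) P \<and>
       H (?u (d j (Suc i)) i' \<omega>) - H (?u (d (Suc j) (2 * i + 1)) i' \<omega>) \<le> min (A / 2 ^ j) P"
      using inc[OF w, of "d j i" "d (Suc j) (2 * i + 1)"] inc[OF w, of "d (Suc j) (2 * i + 1)" "d j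
          (Suc i)"] le
      unfolding diffs by simp
  qed (use A P01 \<epsilon> \<beta>0 in auto)
  have "emeasure M B1 \<le> (\<Sum>j. emeasure M (\<Union>i<2 ^ j. Bad j i))"
    unfolding B1_def using Bad_sets by (intro emeasure_subadditive_countably) auto
  also have "\<dots> \<le> (\<Sum>j. ennreal (11 * K\<^sup>2 / \<epsilon> ^ 4 * (2 ^ j * (min (A / 2 ^ j) P)\<^sup>2 / \<beta> j ^ 4)))"
  proof (intro suminf_le summableI)
    fix j
    have "emeasure M (\<Union>i<2 ^ j. Bad j i) \<le> (\<Sum>i<2 ^ j. emeasure M (Bad j i))"
      using Bad_sets by (intro emeasure_subadditive_finite) auto
    also have "\<dots> \<le> (\<Sum>i<(2::nat) ^ j. ennreal (11 * K\<^sup>2 * (min (A / 2 ^ j) P * min (A / 2 ^ j) P) /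
        (\<epsilon> * \<beta> j) ^ 4))"
      using Bad_le by (intro sum_mono) auto
    also have "\<dots> = ennreal (\<Sum>i<(2::nat) ^ j. 11 * K\<^sup>2 * (min (A / 2 ^ j) P * min (A / 2 ^ j) P) / (\<epsilon>
        * \<beta> j) ^ 4)"
      using \<epsilon> \<beta>0[of j] by (intro sum_ennreal) auto
    also have "(\<Sum>i<(2::nat) ^ j. 11 * K\<^sup>2 * (min (A / 2 ^ j) P * min (A / 2 ^ j) P) / (\<epsilon> * \<beta> j) ^ 4)
       = 11 * K\<^sup>2 / \<epsilon> ^ 4 * (2 ^ j * (min (A / 2 ^ j) P)\<^sup>2 / \<beta> j ^ 4)"
      by (simp add: power2_eq_square power_mult_distrib)
    finally show "emeasure M (\<Union>i<2 ^ j. Bad j i) \<le> ennreal (11 * K\<^sup>2 / \<epsilon> ^ 4 * (2 ^ j * (min (A / 2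
        ^ j) P)\<^sup>2 / \<beta> j ^ 4))" .
  qed
  also have "\<dots> \<le> ennreal (11 * K\<^sup>2 / \<epsilon> ^ 4 * (3200000 * (A * P)))"
  proof (rule suminf_le_const[OF summableI])
    fix J
    have "(\<Sum>j<J. ennreal (11 * K\<^sup>2 / \<epsilon> ^ 4 * (2 ^ j * (min (A / 2 ^ j) P)\<^sup>2 / \<beta> j ^ 4)))
       = ennreal (\<Sum>j<J. 11 * K\<^sup>2 / \<epsilon> ^ 4 * (2 ^ j * (min (A / 2 ^ j) P)\<^sup>2 / \<beta> j ^ 4))"
      using \<epsilon> \<beta>0 by (intro sum_ennreal) (auto intro!: mult_nonneg_nonneg divide_nonneg_nonneg less_imp_le)
    also have "\<dots> \<le> ennreal (11 * K\<^sup>2 / \<epsilon> ^ 4 * (3200000 * (A * P)))"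
      unfolding sum_distrib_left[symmetric] using \<beta>2[of J] \<epsilon> by (intro ennreal_leI mult_left_mono) auto
    finally show "(\<Sum>j<J. ennreal (11 * K\<^sup>2 / \<epsilon> ^ 4 * (2 ^ j * (min (A / 2 ^ j) P)\<^sup>2 / \<beta> j ^ 4))) \<le>
        ennreal (11 * K\<^sup>2 / \<epsilon> ^ 4 * (3200000 * (A * P)))" .
  qed
  finally have B1: "emeasure M B1 \<le> ennreal (11 * K\<^sup>2 / \<epsilon> ^ 4 * (3200000 * (A * P)))" .
  have B2: "emeasure M B2 \<le> ennreal ((8 * K\<^sup>2 * P\<^sup>2 + 3 * L\<^sup>2 * K * P) / \<epsilon> ^ 4)"
    unfolding B2_def
  proof (rule single_increment_tail[OF pred(1) predictable_shift[OF pred(2,3)] predictable_shift[OF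
      pred(2,3)] _ budget cap P01(1) \<epsilon>])
    fix \<omega> i assume w: "\<omega> \<in> space M" "1 \<le> i" "i \<le> n" "c i \<omega> \<noteq> 0"
    show "?u x i \<omega> \<le> ?u (x + l) i \<omega> \<and> H (?u (x + l) i \<omega>) - H (?u x i \<omega>) \<le> P"
      using inc[OF w, of x "x + l"] l by auto
  qed auto
  have "emeasure M (B1 \<union> B2) \<le> emeasure M B1 + emeasure M B2"
    using sets by (rule emeasure_subadditive)
  also have "\<dots> \<le> ennreal (11 * K\<^sup>2 / \<epsilon> ^ 4 * (3200000 * (A * P))) + ennreal ((8 * K\<^sup>2 * P\<^sup>2 + 3 *
      L\<^sup>2 * K * P) / \<epsilon> ^ 4)"
    using B1 B2 by (rule add_mono)
  also have "\<dots> = ennreal (11 * K\<^sup>2 / \<epsilon> ^ 4 * (3200000 * (A * P)) + (8 * K\<^sup>2 * P\<^sup>2 + 3 * L\<^sup>2 * K * P) / \<epsilon> ^ 4)"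
    using A P01 K0 \<epsilon> by (intro ennreal_plus[symmetric]) auto
  also have "11 * K\<^sup>2 / \<epsilon> ^ 4 * (3200000 * (A * P)) + (8 * K\<^sup>2 * P\<^sup>2 + 3 * L\<^sup>2 * K * P) / \<epsilon> ^ 4
     = (35200000 * K\<^sup>2 * (C / m * P) + 8 * K\<^sup>2 * P\<^sup>2 + 3 * L\<^sup>2 * K * P) / \<epsilon> ^ 4"
    by (simp add: A_def l_def add_divide_distrib ac_simps)
  finally have em: "emeasure M (B1 \<union> B2) \<le> ennreal ((35200000 * K\<^sup>2 * (C / m * P) + 8 * K\<^sup>2 * P\<^sup>2 +
      3 * L\<^sup>2 * K * P) / \<epsilon> ^ 4)" .
  have good: "\<bar>shifted_sum n c T Z t \<omega> - shifted_sum n c T Z x \<omega>\<bar> \<le> 2 * \<epsilon>"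
    if w: "\<omega> \<in> space M - (B1 \<union> B2)" and t: "x \<le> t" "t \<le> x + 1 / real m" for \<omega> t
  proof -
    define f where "f t = shifted_sum n c T Z t \<omega>" for t
    have f_inc: "f t - f s = bracket_sum n c (?u s) (?u t) n \<omega>" if "s \<le> t" for s t
      unfolding f_def using w that by (intro shifted_sum_increment) (auto intro: T1)
    have end_inc: "\<bar>f (x + l) - f x\<bar> \<le> \<epsilon>"
      using w f_inc[of x "x + l"] l by (auto simp: B2_def not_less)
    have ch: "min \<bar>f (dyadic x l J i) - f x\<bar> \<bar>f (x + l) - f (dyadic x l J i)\<bar> \<le> (\<Sum>j<J. \<epsilon> * \<beta> j)"
      if "i \<le> 2 ^ J" for i J
    proof (rule dyadic_three_point_chaining[OF _ that])
      fix j i :: nat assume "i < 2 ^ j"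
      then have "\<omega> \<notin> Bad j i" using w unfolding B1_def by blast
      then show "min \<bar>f (dyadic x l (Suc j) (2 * i + 1)) - f (dyadic x l j i)\<bar>
          \<bar>f (dyadic x l j (Suc i)) - f (dyadic x l (Suc j) (2 * i + 1))\<bar> \<le> \<epsilon> * \<beta> j"
        using w f_inc[OF dd(1)[of j i]] f_inc[OF dd(2)[of j i]] unfolding Bad_def d_def by (simp
            add: not_less min_le_iff_disj)
    qed
    have "\<bar>f t - f x\<bar> \<le> 2 * \<epsilon>"
    proof (rule right_continuous_bound_from_dyadics[OF l(1), where a = x and f = f])
      show "continuous (at_right s) f" for s
        unfolding f_def[abs_def] using w by (intro shifted_sum_right_continuous) (auto intro: T1)
      show "\<bar>f (dyadic x l J i) - f x\<bar> \<le> 2 * \<epsilon>" if "i \<le> 2 ^ J" for J i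
      proof -
        have "(\<Sum>j<J. \<epsilon> * \<beta> j) \<le> \<epsilon>"
          using \<beta>1[of J] \<epsilon> by (simp flip: sum_distrib_left)
        then show ?thesis using ch[OF that] end_inc \<epsilon> by linarith
      qed
    qed (use t in \<open>auto simp: l_def\<close>)
    then show ?thesis by (simp add: f_def)
  qed
  show ?thesis using sets em good by (intro bexI[of _ "B1 \<union> B2"] conjI ballI allI impI) auto
qed

end

section \<open>Summing over the cells of the line\<close>

context lipschitz_moment_array begin

lemma moment_bound_nonneg: "0 \<le> \<mu>"
proof -
  interpret L: real_distribution law by (rule law_real_distribution)
  have "1 = (\<integral>\<^sup>+y. 1 \<partial>law)" using L.emeasure_space_1 by simp
  also have "\<dots> \<le> (\<integral>\<^sup>+y. ennreal (1 + \<bar>y\<bar>) \<partial>law)" by (intro nn_integral_mono) simp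
  also have "\<dots> \<le> ennreal \<mu>" by (rule moment)
  finally show ?thesis by (metis ennreal_neg linear not_one_le_zero)
qed

text \<open>
  For m at least 6 the radius of the window is at most half of \<open>1 + \<bar>k / m\<bar>\<close>.
\<close>

lemma window_comparable:
  assumes m: "6 \<le> m" and y: "y \<in> window m k"
  shows "1 + \<bar>of_int k / real m\<bar> \<le> 2 * (1 + \<bar>y\<bar>)"
proof -
  define x where "x = of_int k / real m"
  have "\<bar>y - x\<bar> \<le> 3 * (1 + \<bar>x\<bar>) / real m" using y by (simp add: window_def x_def)
  also have "\<dots> \<le> 3 * (1 + \<bar>x\<bar>) / 6" using m by (intro divide_left_mono) auto
  finally have "\<bar>y - x\<bar> \<le> (1 + \<bar>x\<bar>) / 2" by simp
  moreover have "\<bar>x\<bar> \<le> \<bar>y\<bar> + \<bar>y - x\<bar>" by simp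
  ultimately show ?thesis unfolding x_def[symmetric] by argo
qed

text \<open>
  The mass is O((1 + |x|) / m) by the Lipschitz bound and O(1 / (1 + |x|)) by Markov's inequality,
  where x is the centre of the window; the product of the two bounds is independent of x.
\<close>

lemma measure_window_le:
  assumes m: "6 \<le> m"
  shows "measure law (window m k) \<le> sqrt (18 * C * \<mu> / real m)"
proof -
  interpret L: real_distribution law by (rule law_real_distribution)
  define x where "x = of_int k / real m"
  define r where "r = 3 * (1 + \<bar>x\<bar>) / real m"
  define P where "P = measure law (window m k)"
  have r: "0 < r" using m by (simp add: r_def)
  have P0: "0 \<le> P" by (simp add: P_def)
  have "window m k = {y. \<bar>y - x\<bar> \<le> r}" by (simp add: window_def x_def r_def)
  \<comment> \<open>A half-open interval, whose mass is an increment of H.\<close>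
  then have "window m k \<subseteq> {x - 2 * r<..x + r}" using r by auto
  then have "P \<le> measure law {x - 2 * r<..x + r}"
    unfolding P_def by (intro L.finite_measure_mono) auto
  also have "\<dots> \<le> C * (3 * r)"
    using H_lipschitz[of "x - 2 * r" "x + r"] r by (subst measure_law_interval) auto
  finally have P1: "P \<le> C * (3 * r)" .
  have "ennreal ((1 + \<bar>x\<bar>) / 2 * P) = (\<integral>\<^sup>+y. ennreal ((1 + \<bar>x\<bar>) / 2) * indicator (window m k) y \<partial>law)"
    using P0 by (simp add: nn_integral_cmult L.emeasure_eq_measure P_def[symmetric] ennreal_mult[symmetric])
  also have "\<dots> \<le> (\<integral>\<^sup>+y. ennreal (1 + \<bar>y\<bar>) \<partial>law)"
  proof (rule nn_integral_mono)
    fix y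
    show "ennreal ((1 + \<bar>x\<bar>) / 2) * indicator (window m k) y \<le> ennreal (1 + \<bar>y\<bar>)"
    proof (cases "y \<in> window m k")
      case True
      have "ennreal ((1 + \<bar>x\<bar>) / 2) \<le> ennreal (1 + \<bar>y\<bar>)"
        using window_comparable[OF m True] by (intro ennreal_leI) (simp add: x_def)
      then show ?thesis using True by (simp del: ennreal_plus)
    qed simp
  qed
  also note moment
  finally have P2: "(1 + \<bar>x\<bar>) / 2 * P \<le> \<mu>" using moment_bound_nonneg by (simp add: ennreal_le_iff)
  have "P\<^sup>2 \<le> P * (C * (3 * r))" using P1 P0 by (simp add: power2_eq_square mult_left_mono)
  also have "\<dots> = 18 * C / real m * ((1 + \<bar>x\<bar>) / 2 * P)" using m by (simp add: r_def field_simps)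
  also have "\<dots> \<le> 18 * C / real m * \<mu>" using P2 C_pos by (intro mult_left_mono) auto
  finally show ?thesis unfolding P_def[symmetric] by (intro real_le_rsqrt) simp
qed

text \<open>
  A point y lies in the window of k only if k is within 6 (1 + |y|) of m y, and hence in at most 13
  (1 + |y|) windows.
\<close>

lemma sum_windows_le:
  assumes m: "6 \<le> m"
  shows "(\<Sum>j. emeasure law (window m (int_decode j))) \<le> ennreal (13 * \<mu>)"
proof -
  interpret L: real_distribution law by (rule law_real_distribution)
  have "(\<Sum>j. emeasure law (window m (int_decode j))) = (\<integral>\<^sup>+y. (\<Sum>j. indicator (window m (int_decode
      j)) y) \<partial>law)"
    by (subst nn_integral_suminf) auto
  also have "\<dots> \<le> (\<integral>\<^sup>+y. 13 * ennreal (1 + \<bar>y\<bar>) \<partial>law)"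
  proof (rule nn_integral_mono)
    fix y :: real
    define r where "r = 6 * (1 + \<bar>y\<bar>)"
    have r0: "0 \<le> r" by (simp add: r_def)
    define N where "N = {j. y \<in> window m (int_decode j)}"
    have sub: "int_decode ` N \<subseteq> {\<lceil>real m * y - r\<rceil>..\<lfloor>real m * y + r\<rfloor>}"
    proof (safe, unfold N_def mem_Collect_eq)
      fix j assume "y \<in> window m (int_decode j)"
      moreover define k where "k = int_decode j"
      ultimately have k: "y \<in> window m k" by simp
      have "real m * \<bar>y - of_int k / real m\<bar> \<le> real m * (3 * (1 + \<bar>of_int k / real m\<bar>) / real m)"
        using k by (intro mult_left_mono) (auto simp: window_def)
      also have "\<dots> \<le> r" using window_comparable[OF m k] m by (simp add: r_def)
      also have "real m * \<bar>y - of_int k / real m\<bar> = \<bar>real m * y - of_int k\<bar>"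
      proof -
        have "real m * (y - of_int k / real m) = real m * y - of_int k" using m by (simp add: field_simps)
        then show ?thesis by (metis abs_mult abs_of_nat)
      qed
      finally have "\<bar>real m * y - of_int k\<bar> \<le> r" .
      then show "int_decode j \<in> {\<lceil>real m * y - r\<rceil>..\<lfloor>real m * y + r\<rfloor>}"
        unfolding k_def[symmetric] by (auto simp: ceiling_le_iff le_floor_iff)
    qed
    have inj: "inj_on int_decode N" using bij_int_decode by (auto simp: bij_def intro: inj_on_subset)
    have fin: "finite N" using finite_subset[OF sub] inj by (auto dest: finite_imageD)
    have "card N = card (int_decode ` N)" using inj by (rule card_image[symmetric])
    also have "\<dots> \<le> card {\<lceil>real m * y - r\<rceil>..\<lfloor>real m * y + r\<rfloor>}" by (rule card_mono[OF _ sub]) simp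
    finally have "card N \<le> nat (\<lfloor>real m * y + r\<rfloor> + 1 - \<lceil>real m * y - r\<rceil>)" by simp
    then have "real (card N) \<le> max 0 (of_int (\<lfloor>real m * y + r\<rfloor> + 1 - \<lceil>real m * y - r\<rceil>))"
      by linarith
    also have "\<dots> \<le> 2 * r + 1"
      using of_int_floor_le[of "real m * y + r"] le_of_int_ceiling[of "real m * y - r"] r0
      unfolding of_int_add of_int_diff of_int_1 by linarith
    finally have "real (card N) \<le> 2 * r + 1" .
    also have "\<dots> \<le> 13 * (1 + \<bar>y\<bar>)" by (simp add: r_def)
    finally have card: "real (card N) \<le> 13 * (1 + \<bar>y\<bar>)" .
    have "(\<Sum>j. indicator (window m (int_decode j)) y :: ennreal) = (\<Sum>j\<in>N. indicator (window m
        (int_decode j)) y)"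
      by (rule suminf_finite[OF fin]) (auto simp: N_def)
    also have "\<dots> = ennreal (real (card N))" by (simp add: N_def ennreal_of_nat_eq_real_of_nat)
    also have "\<dots> \<le> ennreal (13 * (1 + \<bar>y\<bar>))" using card by (rule ennreal_leI)
    also have "\<dots> = 13 * ennreal (1 + \<bar>y\<bar>)" by (subst ennreal_mult) auto
    finally show "(\<Sum>j. indicator (window m (int_decode j)) y :: ennreal) \<le> 13 * ennreal (1 + \<bar>y\<bar>)" .
  qed
  also have "\<dots> = 13 * (\<integral>\<^sup>+y. ennreal (1 + \<bar>y\<bar>) \<partial>law)" by (rule nn_integral_cmult) simp
  also have "\<dots> \<le> 13 * ennreal \<mu>" by (intro mult_left_mono moment) simp
  also have "\<dots> = ennreal (13 * \<mu>)" using moment_bound_nonneg by (subst ennreal_mult) auto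
  finally show ?thesis .
qed

text \<open>
  Countable subadditivity over the integers, enumerated by \<open>int_decode\<close>.
\<close>

lemma exceptional_events_union:
  assumes m: "6 \<le> m" and \<kappa>: "0 \<le> \<kappa>"
    and ex: "\<And>k. \<exists>B\<in>sets M. emeasure M B \<le> ennreal (\<kappa> * measure law (window m k)) \<and> (\<forall>\<omega>\<in>space M - B. R k \<omega>)"
  shows "\<exists>B\<in>sets M. emeasure M B \<le> ennreal (13 * \<mu> * \<kappa>) \<and> (\<forall>\<omega>\<in>space M - B. \<forall>k. R k \<omega>)"
proof -
  interpret L: real_distribution law by (rule law_real_distribution)
  obtain B where B: "\<And>k. B k \<in> sets M" "\<And>k. emeasure M (B k) \<le> ennreal (\<kappa> * measure law (window m k))"
      "\<And>k \<omega>. \<omega> \<in> space M - B k \<Longrightarrow> R k \<omega>"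
    using ex by metis
  define U where "U = (\<Union>j. B (int_decode j))"
  have "emeasure M U \<le> (\<Sum>j. emeasure M (B (int_decode j)))"
    unfolding U_def using B by (intro emeasure_subadditive_countably) auto
  also have "\<dots> \<le> (\<Sum>j. ennreal \<kappa> * emeasure law (window m (int_decode j)))"
    using B(2) \<kappa> by (intro suminf_le summableI) (simp add: L.emeasure_eq_measure ennreal_mult)
  also have "\<dots> = ennreal \<kappa> * (\<Sum>j. emeasure law (window m (int_decode j)))" by simp
  also have "\<dots> \<le> ennreal \<kappa> * ennreal (13 * \<mu>)" by (intro mult_left_mono sum_windows_le m) simp
  also have "\<dots> = ennreal (13 * \<mu> * \<kappa>)" using \<kappa> moment_bound_nonneg by (simp add: ennreal_mult
      mult.commute flip: ennreal_mult)
  finally have "emeasure M U \<le> ennreal (13 * \<mu> * \<kappa>)" .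
  moreover have "U \<in> sets M" unfolding U_def using B by auto
  moreover have "R k \<omega>" if "\<omega> \<in> space M - U" for k \<omega>
  proof (rule B(3))
    have "k = int_decode (int_encode k)" by simp
    then show "\<omega> \<in> space M - B k" using that unfolding U_def by (metis DiffD1 DiffD2 DiffI UNIV_I UN_I)
  qed
  ultimately show ?thesis by blast
qed

text \<open>
  At a fixed point the difference of the two processes is itself a predictably weighted sum of
  centred indicators of intervals: the interval has end points x and \<open>x + x T i + Z i\<close>,
  and the weight changes sign when the second lies to the left of the first.
\<close>

lemma grid_deviation:
  fixes k :: int and m n :: nat and K L \<epsilon> :: real
  defines "x \<equiv> of_int k / real m"
  assumes pred: "predictable n c" "predictable n T" "predictable n Z"
    and m: "2 \<le> m"
    and small: "\<And>i \<omega>. \<omega> \<in> space M \<Longrightarrow> 1 \<le> i \<Longrightarrow> i \<le> n \<Longrightarrow> c i \<omega> \<noteq> 0 \<Longrightarrow>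
        \<bar>T i \<omega>\<bar> \<le> 1 / real m \<and> \<bar>Z i \<omega>\<bar> \<le> 1 / real m"
    and budget: "\<And>\<omega>. \<omega> \<in> space M \<Longrightarrow> (\<Sum>i=1..n. (c i \<omega>)\<^sup>2) \<le> K"
    and cap: "\<And>i \<omega>. \<omega> \<in> space M \<Longrightarrow> 1 \<le> i \<Longrightarrow> i \<le> n \<Longrightarrow> (c i \<omega>)\<^sup>2 \<le> L\<^sup>2"
    and \<epsilon>: "0 < \<epsilon>"
  defines "P \<equiv> measure law (window m k)"
  shows "\<exists>B\<in>sets M. emeasure M B \<le> ennreal ((8 * K\<^sup>2 * P\<^sup>2 + 3 * L\<^sup>2 * K * P) / \<epsilon> ^ 4) \<and>
    (\<forall>\<omega>\<in>space M - B.
        \<bar>shifted_sum n c T Z x \<omega> - shifted_sum n c (\<lambda>_ _. 0) (\<lambda>_ _. 0) x \<omega>\<bar> \<le> \<epsilon>)"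
proof -
  interpret L: real_distribution law by (rule law_real_distribution)
  let ?u = "shift T Z x"
  define c' where "c' i \<omega> = (if x \<le> ?u i \<omega> then c i \<omega> else - c i \<omega>)" for i \<omega>
  define a where "a i \<omega> = min x (?u i \<omega>)" for i \<omega>
  define b where "b i \<omega> = max x (?u i \<omega>)" for i \<omega>
  have pred': "predictable n c'" "predictable n a" "predictable n b"
    unfolding predictable_def
  proof (safe)
    fix i j assume ij: "1 \<le> i" "i \<le> j" "j \<le> n"
    have [measurable]: "c i \<in> borel_measurable (\<A> n j)" "?u i \<in> borel_measurable (\<A> n j)"
      using pred ij by (auto intro!: predictableD predictable_shift)
    show "c' i \<in> borel_measurable (\<A> n j)" unfolding c'_def[abs_def] by measurable
    show "a i \<in> borel_measurable (\<A> n j)" unfolding a_def[abs_def] by measurable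
    show "b i \<in> borel_measurable (\<A> n j)" unfolding b_def[abs_def] by measurable
  qed
  have sq: "(c' i \<omega>)\<^sup>2 = (c i \<omega>)\<^sup>2" for i \<omega> by (simp add: c'_def)
  have eq: "shifted_sum n c T Z x \<omega> - shifted_sum n c (\<lambda>_ _. 0) (\<lambda>_ _. 0) x \<omega> = bracket_sum n c' a b
      n \<omega>" for \<omega>
    unfolding shifted_sum_def bracket_sum_def sum_subtractf[symmetric]
    by (rule sum.cong) (auto simp: c'_def a_def b_def min_def max_def algebra_simps)
  define B where "B = {\<omega> \<in> space M. \<epsilon> < \<bar>bracket_sum n c' a b n \<omega>\<bar>}"
  have [measurable]: "bracket_sum n c' a b n \<in> borel_measurable M"
    by (rule bracket_sum_measurable[OF pred' order_refl])
  have "B \<in> sets M" unfolding B_def by measurable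
  moreover have "emeasure M B \<le> ennreal ((8 * K\<^sup>2 * P\<^sup>2 + 3 * L\<^sup>2 * K * P) / \<epsilon> ^ 4)"
    unfolding B_def
  proof (rule single_increment_tail[OF pred'])
    fix \<omega> i assume w: "\<omega> \<in> space M" "1 \<le> i" "i \<le> n" "c' i \<omega> \<noteq> 0"
    then have c: "c i \<omega> \<noteq> 0" by (auto simp: c'_def split: if_splits)
    have "?u i \<omega> \<in> window m k"
      by (rule shift_in_window) (use small[OF w(1-3) c] m in \<open>auto simp: x_def\<close>)
    moreover have "x \<in> window m k" by (simp add: window_def x_def)
    ultimately have "{a i \<omega><..b i \<omega>} \<subseteq> window m k"
      unfolding window_def a_def b_def by (auto simp: min_def max_def split: if_splits)
    moreover have le: "a i \<omega> \<le> b i \<omega>" by (simp add: a_def b_def)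
    ultimately show "a i \<omega> \<le> b i \<omega> \<and> H (b i \<omega>) - H (a i \<omega>) \<le> P"
      unfolding P_def measure_law_interval[OF le, symmetric] by (auto intro!: L.finite_measure_mono)
  qed (use budget cap \<epsilon> in \<open>auto simp: sq P_def\<close>)
  ultimately show ?thesis unfolding eq by (intro bexI[of _ B]) (auto simp: B_def not_less)
qed

text \<open>
  On each cell, 5 = 2 + 2 + 1 adds the oscillations of the two processes and their distance at the
  left end point, and the three exceptional events give the factor 39 = 3 * 13.
\<close>

lemma uniform_closeness:
  fixes m n :: nat and K L \<epsilon> :: real
  assumes pred: "predictable n c" "predictable n T" "predictable n Z"
    and m: "6 \<le> m"
    and small: "\<And>i \<omega>. \<omega> \<in> space M \<Longrightarrow> 1 \<le> i \<Longrightarrow> i \<le> n \<Longrightarrow> c i \<omega> \<noteq> 0 \<Longrightarrow>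
        \<bar>T i \<omega>\<bar> \<le> 1 / real m \<and> \<bar>Z i \<omega>\<bar> \<le> 1 / real m"
    and budget: "\<And>\<omega>. \<omega> \<in> space M \<Longrightarrow> (\<Sum>i=1..n. (c i \<omega>)\<^sup>2) \<le> K"
    and cap: "\<And>i \<omega>. \<omega> \<in> space M \<Longrightarrow> 1 \<le> i \<Longrightarrow> i \<le> n \<Longrightarrow> (c i \<omega>)\<^sup>2 \<le> L\<^sup>2"
    and \<epsilon>: "0 < \<epsilon>"
  shows "\<exists>B\<in>sets M. emeasure M B \<le> ennreal (39 * \<mu> *
      ((35200000 * K\<^sup>2 * (C / m) + 8 * K\<^sup>2 * sqrt (18 * C * \<mu> / m) + 3 * L\<^sup>2 * K) / \<epsilon> ^ 4)) \<and>
    (\<forall>\<omega>\<in>space M - B. \<forall>t.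
        \<bar>shifted_sum n c T Z t \<omega> - shifted_sum n c (\<lambda>_ _. 0) (\<lambda>_ _. 0) t \<omega>\<bar> \<le> 5 * \<epsilon>)"
proof -
  have K0: "0 \<le> K" using budget by (rule budget_nonneg)
  define s where "s = sqrt (18 * C * \<mu> / m)"
  have s0: "0 \<le> s" using C_pos moment_bound_nonneg by (simp add: s_def)
  define \<kappa> where "\<kappa> = (35200000 * K\<^sup>2 * (C / m) + 8 * K\<^sup>2 * s + 3 * L\<^sup>2 * K) / \<epsilon> ^ 4"
  have \<kappa>0: "0 \<le> \<kappa>" using K0 s0 C_pos \<epsilon> by (simp add: \<kappa>_def)
  let ?O = "\<lambda>_ _. 0 :: real"
  let ?X = "shifted_sum n c T Z" and ?Y = "shifted_sum n c ?O ?O"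
  let ?x = "\<lambda>k::int. of_int k / real m"
  have pred0: "predictable n ?O" by (simp add: predictable_def)
  have "\<exists>B\<in>sets M. emeasure M B \<le> ennreal (3 * \<kappa> * measure law (window m k)) \<and>
     (\<forall>\<omega>\<in>space M - B. \<forall>t. ?x k \<le> t \<longrightarrow> t \<le> ?x k + 1 / real m \<longrightarrow> \<bar>?X t \<omega> - ?Y t \<omega>\<bar> \<le> 5 * \<epsilon>)" for k
  proof -
    define P where "P = measure law (window m k)"
    have P: "0 \<le> P" "P \<le> s" using measure_window_le[OF m, of k] by (auto simp: P_def s_def)
    have "P\<^sup>2 \<le> s * P" using P mult_right_mono[of P s P] by (simp add: power2_eq_square)
    then have "8 * K\<^sup>2 * P\<^sup>2 \<le> 8 * K\<^sup>2 * (s * P)" by (intro mult_left_mono) auto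
    then have PP: "8 * K\<^sup>2 * P\<^sup>2 \<le> 8 * K\<^sup>2 * s * P" by (simp only: mult.assoc)
    have le1: "(35200000 * K\<^sup>2 * (C / m * P) + 8 * K\<^sup>2 * P\<^sup>2 + 3 * L\<^sup>2 * K * P) / \<epsilon> ^ 4 \<le> \<kappa> * P"
    proof -
      have "(35200000 * K\<^sup>2 * (C / m * P) + 8 * K\<^sup>2 * P\<^sup>2 + 3 * L\<^sup>2 * K * P) / \<epsilon> ^ 4
        \<le> (35200000 * K\<^sup>2 * (C / m) * P + 8 * K\<^sup>2 * s * P + 3 * L\<^sup>2 * K * P) / \<epsilon> ^ 4"
        using PP \<epsilon> by (intro divide_right_mono) auto
      also have "\<dots> = \<kappa> * P" by (simp add: \<kappa>_def distrib_right)
      finally show ?thesis .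
    qed
    have le2: "(8 * K\<^sup>2 * P\<^sup>2 + 3 * L\<^sup>2 * K * P) / \<epsilon> ^ 4 \<le> \<kappa> * P"
      using C_pos P K0 \<epsilon> by (intro order_trans[OF _ le1] divide_right_mono) auto
    have small0: "\<bar>?O i \<omega>\<bar> \<le> 1 / real m \<and> \<bar>?O i \<omega>\<bar> \<le> 1 / real m" for i and \<omega> :: 'a by simp
    have m2: "2 \<le> m" using m by simp
    have osc: "\<exists>B\<in>sets M. emeasure M B \<le> ennreal (\<kappa> * P) \<and> (\<forall>\<omega>\<in>space M - B. \<forall>t. ?x k \<le> t \<longrightarrow> t \<le> ?x k
        + 1 / real m \<longrightarrow>
        \<bar>shifted_sum n c T' Z' t \<omega> - shifted_sum n c T' Z' (?x k) \<omega>\<bar> \<le> 2 * \<epsilon>)"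
      if T': "predictable n T'" "predictable n Z'"
        "\<And>i \<omega>. \<omega> \<in> space M \<Longrightarrow> 1 \<le> i \<Longrightarrow> i \<le> n \<Longrightarrow> c i \<omega> \<noteq> 0 \<Longrightarrow> \<bar>T' i \<omega>\<bar> \<le> 1 / real m \<and> \<bar>Z' i \<omega>\<bar> \<le> 1 / real
            m" for T' Z'
    proof -
      have "\<exists>B\<in>sets M. emeasure M B \<le> ennreal ((35200000 * K\<^sup>2 * (C / m * P) + 8 * K\<^sup>2 * P\<^sup>2 + 3 *
          L\<^sup>2 * K * P) / \<epsilon> ^ 4) \<and>
        (\<forall>\<omega>\<in>space M - B. \<forall>t. ?x k \<le> t \<longrightarrow> t \<le> ?x k + 1 / real m \<longrightarrow>
        \<bar>shifted_sum n c T' Z' t \<omega> - shifted_sum n c T' Z' (?x k) \<omega>\<bar> \<le> 2 * \<epsilon>)"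
        unfolding P_def by (rule cell_oscillation[OF pred(1) T'(1,2) m2 T'(3) budget cap \<epsilon>])
      then show ?thesis using ennreal_leI[OF le1] by (meson order_trans)
    qed
    obtain B1 where B1: "B1 \<in> sets M" "emeasure M B1 \<le> ennreal (\<kappa> * P)"
      "\<And>\<omega> t. \<omega> \<in> space M - B1 \<Longrightarrow> ?x k \<le> t \<Longrightarrow> t \<le> ?x k + 1 / real m \<Longrightarrow> \<bar>?X t \<omega> - ?X (?x k) \<omega>\<bar> \<le> 2 * \<epsilon>"
      using osc[OF pred(2,3) small] by blast
    obtain B2 where B2: "B2 \<in> sets M" "emeasure M B2 \<le> ennreal (\<kappa> * P)"
      "\<And>\<omega> t. \<omega> \<in> space M - B2 \<Longrightarrow> ?x k \<le> t \<Longrightarrow> t \<le> ?x k + 1 / real m \<Longrightarrow> \<bar>?Y t \<omega> - ?Y (?x k) \<omega>\<bar> \<le> 2 * \<epsilon>"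
      using osc[OF pred0 pred0 small0] by blast
    have "\<exists>B\<in>sets M. emeasure M B \<le> ennreal ((8 * K\<^sup>2 * P\<^sup>2 + 3 * L\<^sup>2 * K * P) / \<epsilon> ^ 4) \<and>
        (\<forall>\<omega>\<in>space M - B. \<bar>?X (?x k) \<omega> - ?Y (?x k) \<omega>\<bar> \<le> \<epsilon>)"
      unfolding P_def by (rule grid_deviation[OF pred m2 small budget cap \<epsilon>])
    then obtain B3 where B3: "B3 \<in> sets M" "emeasure M B3 \<le> ennreal (\<kappa> * P)"
      "\<And>\<omega>. \<omega> \<in> space M - B3 \<Longrightarrow> \<bar>?X (?x k) \<omega> - ?Y (?x k) \<omega>\<bar> \<le> \<epsilon>"
      using ennreal_leI[OF le2] by (meson order_trans)
    have "emeasure M (B1 \<union> B2 \<union> B3) \<le> emeasure M B1 + emeasure M B2 + emeasure M B3"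
      using B1 B2 B3 by (intro order_trans[OF emeasure_subadditive] add_right_mono emeasure_subadditive) auto
    also have "\<dots> \<le> ennreal (\<kappa> * P) + ennreal (\<kappa> * P) + ennreal (\<kappa> * P)"
      using B1 B2 B3 by (intro add_mono) auto
    also have "\<dots> = ennreal (3 * \<kappa> * P)" using \<kappa>0 P by (simp flip: ennreal_plus)
    finally have e: "emeasure M (B1 \<union> B2 \<union> B3) \<le> ennreal (3 * \<kappa> * P)" .
    have "\<bar>?X t \<omega> - ?Y t \<omega>\<bar> \<le> 5 * \<epsilon>"
      if "\<omega> \<in> space M - (B1 \<union> B2 \<union> B3)" "?x k \<le> t" "t \<le> ?x k + 1 / real m" for \<omega> t
      using B1(3)[of \<omega> t] B2(3)[of \<omega> t] B3(3)[of \<omega>] that by force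
    then show ?thesis
      using e B1 B2 B3 unfolding P_def by (intro bexI[of _ "B1 \<union> B2 \<union> B3"] conjI ballI) auto
  qed
  from exceptional_events_union[OF m _ this] \<kappa>0
  obtain B where B: "B \<in> sets M" "emeasure M B \<le> ennreal (13 * \<mu> * (3 * \<kappa>))"
    "\<And>\<omega> k t. \<omega> \<in> space M - B \<Longrightarrow> ?x k \<le> t \<Longrightarrow> t \<le> ?x k + 1 / real m \<Longrightarrow> \<bar>?X t \<omega> - ?Y t \<omega>\<bar> \<le> 5 * \<epsilon>"
    by (metis mult_nonneg_nonneg zero_le_numeral)
  have "\<bar>?X t \<omega> - ?Y t \<omega>\<bar> \<le> 5 * \<epsilon>" if "\<omega> \<in> space M - B" for \<omega> t
  proof (rule B(3)[OF that])
    have m0: "0 < real m" using m by simp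
    show "?x \<lfloor>real m * t\<rfloor> \<le> t" using m0 by (simp add: divide_le_eq mult.commute)
    have "real m * t \<le> of_int \<lfloor>real m * t\<rfloor> + 1" by linarith
    then show "t \<le> ?x \<lfloor>real m * t\<rfloor> + 1 / real m"
      using m0 by (simp add: add_divide_distrib[symmetric] le_divide_eq mult.commute)
  qed
  moreover have "emeasure M B \<le> ennreal (39 * \<mu> * \<kappa>)" using B(2) by (simp add: mult.commute mult.left_commute)
  ultimately show ?thesis using B(1) unfolding \<kappa>_def s_def by blast
qed

end

section \<open>The conditions on the density\<close>

context weighted_array begin

lemma law_eq_density:
  assumes h: "is_density_of h H"
  shows "law = density lborel (\<lambda>x. ennreal (h x))"
proof (rule cdf_unique')
  have hm[measurable]: "h \<in> borel_measurable borel" and h0: "\<And>x. 0 \<le> h x" and hi: "integrable lborel h"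
    and H: "\<And>x. H x = (LBINT t:{..x}. h t)"
    using h by (auto simp: is_density_of_def)
  let ?N = "density lborel (\<lambda>x. ennreal (h x))"
  have fin: "emeasure ?N (space ?N) \<noteq> \<infinity>"
    using nn_integral_eq_integral[OF hi] h0 by (simp add: emeasure_density)
  show "finite_borel_measure law"
    by (rule real_distribution.finite_borel_measure_M[OF law_real_distribution])
  show "finite_borel_measure ?N"
    using fin by (intro finite_borel_measure.intro finite_measureI finite_borel_measure_axioms.intro) auto
  show "cdf law = cdf ?N"
  proof
    fix x
    have i: "integrable lborel (\<lambda>t. indicator {..x} t *\<^sub>R h t)"
      using hi by (intro integrable_mult_indicator) auto
    have "emeasure ?N {..x} = (\<integral>\<^sup>+t. ennreal (indicator {..x} t *\<^sub>R h t) \<partial>lborel)"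
      by (subst emeasure_density) (auto intro!: nn_integral_cong simp: indicator_def)
    also have "\<dots> = ennreal (LBINT t:{..x}. h t)"
      using h0 unfolding set_lebesgue_integral_def by (intro nn_integral_eq_integral[OF i]) auto
    finally have "measure ?N {..x} = H x"
      using h0 unfolding H measure_def set_lebesgue_integral_def by (simp add: integral_nonneg_AE)
    then show "cdf law x = cdf ?N x" unfolding cdf_law by (simp add: cdf_def)
  qed
qed

lemma lipschitz_moment_array_of_density:
  assumes h: "is_density_of h H" and bdd: "bdd_above (range h)"
    and mom: "integrable lborel (\<lambda>x. \<bar>x\<bar> * h x)"
  shows "\<exists>C \<mu>. lipschitz_moment_array M \<eta> \<gamma> \<tau> \<xi> \<A> H C \<mu>"
proof -
  have hm[measurable]: "h \<in> borel_measurable borel" and h0: "\<And>x. 0 \<le> h x" and hi: "integrable lborel h"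
    using h by (auto simp: is_density_of_def)
  interpret L: real_distribution law by (rule law_real_distribution)
  obtain C0 where C0: "\<And>x. h x \<le> C0" using bdd by (auto simp: bdd_above_def)
  define C where "C = max 1 C0"
  have C: "0 < C" "\<And>x. h x \<le> C" using C0 by (auto simp: C_def le_max_iff_disj)
  have lip: "H b - H a \<le> C * (b - a)" if ab: "a \<le> b" for a b
  proof -
    have "ennreal (H b - H a) = emeasure law {a<..b}"
      using measure_law_interval[OF ab] by (simp add: L.emeasure_eq_measure)
    also have "\<dots> = (\<integral>\<^sup>+t. ennreal (h t) * indicator {a<..b} t \<partial>lborel)"
      unfolding law_eq_density[OF h] by (subst emeasure_density) auto
    also have "\<dots> \<le> (\<integral>\<^sup>+t. ennreal C * indicator {a<..b} t \<partial>lborel)"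
      using C(2) by (intro nn_integral_mono mult_right_mono ennreal_leI) auto
    also have "\<dots> = ennreal (C * (b - a))"
      using C(1) ab by (simp add: nn_integral_cmult ennreal_mult)
    finally show ?thesis using C(1) ab by (simp add: ennreal_le_iff)
  qed
  define \<mu> where "\<mu> = (\<integral>x. h x + \<bar>x\<bar> * h x \<partial>lborel)"
  have "(\<integral>\<^sup>+y. ennreal (1 + \<bar>y\<bar>) \<partial>law) = (\<integral>\<^sup>+y. ennreal (h y) * ennreal (1 + \<bar>y\<bar>) \<partial>lborel)"
    unfolding law_eq_density[OF h] by (subst nn_integral_density) auto
  also have "\<dots> = (\<integral>\<^sup>+y. ennreal (h y + \<bar>y\<bar> * h y) \<partial>lborel)"
    using h0 by (intro nn_integral_cong) (simp add: ennreal_mult[symmetric] algebra_simps del: ennreal_plus)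
  also have "\<dots> = ennreal \<mu>"
    unfolding \<mu>_def using h0 hi mom by (intro nn_integral_eq_integral) auto
  finally have "(\<integral>\<^sup>+y. ennreal (1 + \<bar>y\<bar>) \<partial>law) \<le> ennreal \<mu>" by simp
  then have "lipschitz_moment_array M \<eta> \<gamma> \<tau> \<xi> \<A> H C \<mu>"
    using C(1) lip by (intro lipschitz_moment_array.intro weighted_array_axioms
        lipschitz_moment_array_axioms.intro)
  then show ?thesis by blast
qed

end

section \<open>Measurability of the supremum\<close>

text \<open>
  A value at a point of continuity is a limit of values at rationals, so the supremum over all x
  equals the supremum over the rationals and the points \<open>p \<omega>\<close>: a countable
  family of measurable functions.
\<close>

lemma borel_measurable_SUP_via_exceptional_points:
  fixes F :: "'a \<Rightarrow> real \<Rightarrow> real"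
  assumes E: "countable E"
    and meas: "\<And>p. p \<in> E \<Longrightarrow> (\<lambda>\<omega>. F \<omega> (p \<omega>)) \<in> borel_measurable M"
    and const: "\<And>q. (\<lambda>\<omega>. F \<omega> q) \<in> borel_measurable M"
    and cont: "\<And>\<omega> x. \<omega> \<in> space M \<Longrightarrow> x \<notin> (\<lambda>p. p \<omega>) ` E \<Longrightarrow> isCont (F \<omega>) x"
    and bdd: "\<And>\<omega>. \<omega> \<in> space M \<Longrightarrow> bdd_above (range (\<lambda>x. \<bar>F \<omega> x\<bar>))"
  shows "(\<lambda>\<omega>. SUP x. \<bar>F \<omega> x\<bar>) \<in> borel_measurable M"
proof -
  define G where "G = E \<union> (\<lambda>q \<omega>. q) ` (\<rat> :: real set)"
  have G: "countable G" "G \<noteq> {}" using E countable_rat by (auto simp: G_def)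
  have eq: "(SUP x. \<bar>F \<omega> x\<bar>) = (SUP g\<in>G. \<bar>F \<omega> (g \<omega>)\<bar>)" if w: "\<omega> \<in> space M" for \<omega>
  proof (rule antisym)
    have bddG: "bdd_above ((\<lambda>g. \<bar>F \<omega> (g \<omega>)\<bar>) ` G)"
      by (rule bdd_above_mono[OF bdd[OF w]]) auto
    show "(SUP g\<in>G. \<bar>F \<omega> (g \<omega>)\<bar>) \<le> (SUP x. \<bar>F \<omega> x\<bar>)"
      using bdd[OF w] G by (intro cSUP_least) (auto intro!: cSUP_upper)
    show "(SUP x. \<bar>F \<omega> x\<bar>) \<le> (SUP g\<in>G. \<bar>F \<omega> (g \<omega>)\<bar>)"
    proof (rule cSUP_least)
      fix x :: real
      show "\<bar>F \<omega> x\<bar> \<le> (SUP g\<in>G. \<bar>F \<omega> (g \<omega>)\<bar>)"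
      proof (cases "x \<in> (\<lambda>p. p \<omega>) ` E")
        case True
        then obtain p where p: "p \<in> E" "x = p \<omega>" by auto
        then have "p \<in> G" by (simp add: G_def)
        from cSUP_upper[OF this bddG] show ?thesis by (simp add: p)
      next
        case False
        have "x \<in> closure \<rat>" by (simp add: Rats_closure_real)
        then obtain q where q: "\<And>n. q n \<in> \<rat>" "q \<longlonglongrightarrow> x" unfolding closure_sequential by blast
        have "(\<lambda>n. \<bar>F \<omega> (q n)\<bar>) \<longlonglongrightarrow> \<bar>F \<omega> x\<bar>"
          by (intro tendsto_rabs isCont_tendsto_compose[OF cont[OF w False] q(2)])
        then show ?thesis
        proof (rule LIMSEQ_le_const2)
          have "\<bar>F \<omega> (q n)\<bar> \<le> (SUP g\<in>G. \<bar>F \<omega> (g \<omega>)\<bar>)" for n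
            using cSUP_upper[OF _ bddG, of "\<lambda>_. q n"] q(1)[of n] by (auto simp: G_def)
          then show "\<exists>N. \<forall>n\<ge>N. \<bar>F \<omega> (q n)\<bar> \<le> (SUP g\<in>G. \<bar>F \<omega> (g \<omega>)\<bar>)" by blast
        qed
      qed
    qed simp
  qed
  have "(\<lambda>\<omega>. SUP g\<in>G. \<bar>F \<omega> (g \<omega>)\<bar>) \<in> borel_measurable M"
  proof (rule borel_measurable_cSUP[OF G(1)])
    fix g assume "g \<in> G"
    then show "(\<lambda>\<omega>. \<bar>F \<omega> (g \<omega>)\<bar>) \<in> borel_measurable M"
      unfolding G_def using meas const by (auto intro!: borel_measurable_abs)
  next
    fix \<omega> assume w: "\<omega> \<in> space M"
    show "bdd_above ((\<lambda>g. \<bar>F \<omega> (g \<omega>)\<bar>) ` G)"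
      by (rule bdd_above_mono[OF bdd[OF w]]) auto
  qed
  then show ?thesis by (subst measurable_cong[OF eq]) auto
qed

lemma isCont_of_bool_le:
  fixes L :: "real \<Rightarrow> real"
  assumes "isCont L x" "L x \<noteq> e"
  shows "isCont (\<lambda>y. of_bool (e \<le> L y) :: real) x"
proof -
  have "\<forall>\<^sub>F y in at x. of_bool (e \<le> L y) = (of_bool (e \<le> L x) :: real)"
  proof (cases "L x < e")
    case True
    then have "\<forall>\<^sub>F y in at x. L y < e" using assms by (intro order_tendstoD) (auto simp: isCont_def)
    then show ?thesis by eventually_elim (use True in auto)
  next
    case False
    then have "\<forall>\<^sub>F y in at x. e < L y" using assms by (intro order_tendstoD) (auto simp: isCont_def)
    then show ?thesis by eventually_elim (use False in auto)
  qed
  then show ?thesis unfolding isCont_def by (rule tendsto_eventually)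
qed

context lipschitz_moment_array begin

text \<open>
  For fixed \<open>\<omega>\<close> the processes can jump only at \<open>\<eta> n i
  \<omega>\<close> and where the argument of the i-th indicator crosses \<open>\<eta> n i
  \<omega>\<close>. When \<open>1 + \<tau> n i \<omega> = 0\<close> that argument is constant and
  the indicator does not jump; the quotient defining the exceptional point is then 0 and does no
  harm. Where \<open>1 + \<tau> n i \<omega>\<close> is negative the i-th summand is left-continuous
  instead of right-continuous, so one-sided limits along rationals need not recover the value at a
  jump.
\<close>

lemma U_difference_SUP_measurable:
  "(\<lambda>\<omega>. SUP x. \<bar>U_tilde \<eta> \<gamma> \<tau> \<xi> H n \<omega> x - U_star \<eta> \<gamma> H n \<omega> x\<bar>) \<in> borel_measurable M"
proof -
  interpret L: real_distribution law by (rule law_real_distribution)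
  define F where "F \<omega> x = U_tilde \<eta> \<gamma> \<tau> \<xi> H n \<omega> x - U_star \<eta> \<gamma> H n \<omega> x" for \<omega> x
  define E where "E = (\<eta> n) ` {1..n} \<union> (\<lambda>i \<omega>. (\<eta> n i \<omega> - \<xi> n i \<omega>) / (1 + \<tau> n i \<omega>)) ` {1..n}"
  have rv: "\<eta> n i \<in> borel_measurable M" "\<gamma> n i \<in> borel_measurable M" "\<tau> n i \<in> borel_measurable M"
      "\<xi> n i \<in> borel_measurable M" if "i \<in> {1..n}" for i
    using random_variables that by auto
  have summand: "(\<lambda>\<omega>. \<gamma> n i \<omega> * (of_bool (\<eta> n i \<omega> \<le> g \<omega>) - H (g \<omega>))) \<in> borel_measurable M"
    if i: "i \<in> {1..n}" and [measurable]: "g \<in> borel_measurable M" for i g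
  proof -
    note rv[OF i, measurable]
    show ?thesis by measurable
  qed
  have Fm: "(\<lambda>\<omega>. F \<omega> (p \<omega>)) \<in> borel_measurable M" if p[measurable]: "p \<in> borel_measurable M" for p
  proof -
    have "(\<lambda>\<omega>. p \<omega> + p \<omega> * \<tau> n i \<omega> + \<xi> n i \<omega>) \<in> borel_measurable M" if "i \<in> {1..n}" for i
      using rv[OF that] p by (intro borel_measurable_add borel_measurable_times)
    then show ?thesis
      unfolding F_def U_tilde_def U_star_def
      by (intro borel_measurable_diff borel_measurable_times borel_measurable_const
          borel_measurable_sum summand p)
  qed
  have Hc: "isCont (\<lambda>x. H (L x)) x" if "isCont L x" for L :: "real \<Rightarrow> real" and x
    using that H_continuous by (rule isCont_o2)
  have "(\<lambda>\<omega>. SUP x. \<bar>F \<omega> x\<bar>) \<in> borel_measurable M"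
  proof (rule borel_measurable_SUP_via_exceptional_points)
    show "countable E" by (simp add: E_def)
    show "(\<lambda>\<omega>. F \<omega> (p \<omega>)) \<in> borel_measurable M" if "p \<in> E" for p
      using that rv unfolding E_def by (intro Fm) (auto intro!: borel_measurable_divide
          borel_measurable_diff borel_measurable_add)
    show "(\<lambda>\<omega>. F \<omega> q) \<in> borel_measurable M" for q by (rule Fm) simp
    show "isCont (F \<omega>) x" if x: "x \<notin> (\<lambda>p. p \<omega>) ` E" for \<omega> x
    proof -
      have 1: "isCont (\<lambda>y. of_bool (\<eta> n i \<omega> \<le> y + y * \<tau> n i \<omega> + \<xi> n i \<omega>) :: real) x" if i: "i \<in> {1..n}" for i
      proof (cases "1 + \<tau> n i \<omega> = 0")
        case True
        then have "y + y * \<tau> n i \<omega> + \<xi> n i \<omega> = \<xi> n i \<omega>" for y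
          by (metis add_0 distrib_left mult.right_neutral mult_zero_right)
        then show ?thesis by simp
      next
        case False
        have "x \<noteq> (\<eta> n i \<omega> - \<xi> n i \<omega>) / (1 + \<tau> n i \<omega>)" using x i by (auto simp: E_def)
        then have "x + x * \<tau> n i \<omega> + \<xi> n i \<omega> \<noteq> \<eta> n i \<omega>" using False by (auto simp: field_simps)
        then show ?thesis by (intro isCont_of_bool_le continuous_intros)
      qed
      have 2: "isCont (\<lambda>y. of_bool (\<eta> n i \<omega> \<le> y) :: real) x" if i: "i \<in> {1..n}" for i
        using x i by (intro isCont_of_bool_le continuous_intros) (auto simp: E_def)
      show ?thesis
        unfolding F_def U_tilde_def U_star_def
        by (intro continuous_diff continuous_mult continuous_sum continuous_const 1 2 Hc continuous_intros)
    qed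
    show "bdd_above (range (\<lambda>x. \<bar>F \<omega> x\<bar>))" for \<omega>
    proof (rule bdd_aboveI2)
      fix x
      have H01: "0 \<le> H y" "H y \<le> 1" for y
        unfolding cdf_law[symmetric] by (auto simp: L.cdf_nonneg L.cdf_bounded_prob)
      have t: "\<bar>\<gamma> n i \<omega> * (of_bool b - H y)\<bar> \<le> \<bar>\<gamma> n i \<omega>\<bar>" for i y b
        using H01[of y] unfolding abs_mult by (intro mult_left_le) auto
      have s: "\<bar>1 / sqrt (real n) * (\<Sum>i=1..n. \<gamma> n i \<omega> * (of_bool (b i) - H (y i)))\<bar>
          \<le> 1 / sqrt (real n) * (\<Sum>i=1..n. \<bar>\<gamma> n i \<omega>\<bar>)" for b y
        unfolding abs_mult by (intro mult_mono order_trans[OF sum_abs] sum_mono t) auto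
      show "\<bar>F \<omega> x\<bar> \<le> 2 * (1 / sqrt (real n) * (\<Sum>i=1..n. \<bar>\<gamma> n i \<omega>\<bar>))"
        unfolding F_def U_tilde_def U_star_def
        using s[of "\<lambda>i. \<eta> n i \<omega> \<le> x + x * \<tau> n i \<omega> + \<xi> n i \<omega>" "\<lambda>i. x + x * \<tau> n i \<omega> + \<xi> n i \<omega>"]
          s[of "\<lambda>i. \<eta> n i \<omega> \<le> x" "\<lambda>_. x"] by linarith
    qed
  qed
  then show ?thesis by (simp add: F_def)
qed

end

section \<open>Truncation of the weights and the limit\<close>

context weighted_array begin

text \<open>
  The partial sum up to i, rather than the whole sum, keeps the truncated weight predictable.
\<close>

definition truncated_weight :: "nat \<Rightarrow> real \<Rightarrow> real \<Rightarrow> nat \<Rightarrow> 'a \<Rightarrow> real" where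
  "truncated_weight n K \<delta> i \<omega> = (if (\<Sum>j=1..i. (\<gamma> n j \<omega>)\<^sup>2) / real n \<le> K \<and>
      1 / sqrt (real n) * \<bar>\<gamma> n i \<omega>\<bar> \<le> \<delta> \<and> \<bar>\<tau> n i \<omega>\<bar> \<le> \<delta> \<and> \<bar>\<xi> n i \<omega>\<bar> \<le> \<delta>
    then \<gamma> n i \<omega> / sqrt (real n) else 0)"

lemma predictable_truncated_weight: "predictable n (truncated_weight n K \<delta>)"
  unfolding predictable_def
proof (intro allI impI)
  fix i j assume ij: "1 \<le> i" "i \<le> j" "j \<le> n"
  have [measurable]: "\<gamma> n i \<in> borel_measurable (\<A> n j)" "\<tau> n i \<in> borel_measurable (\<A> n j)"
    "\<xi> n i \<in> borel_measurable (\<A> n j)"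
    using weights_adapted ij by auto
  have [measurable]: "(\<lambda>\<omega>. \<Sum>k=1..i. (\<gamma> n k \<omega>)\<^sup>2) \<in> borel_measurable (\<A> n j)"
    using weights_adapted ij by (intro borel_measurable_sum borel_measurable_power) auto
  show "truncated_weight n K \<delta> i \<in> borel_measurable (\<A> n j)"
    unfolding truncated_weight_def[abs_def] by measurable
qed

text \<open>
  The weights that survive have indices up to the last one at which the partial sum is still at most
  K.
\<close>

lemma truncated_weight_budget:
  assumes "0 \<le> K"
  shows "(\<Sum>i=1..n. (truncated_weight n K \<delta> i \<omega>)\<^sup>2) \<le> K"
proof -
  define S where "S = {i \<in> {1..n}. (\<Sum>j=1..i. (\<gamma> n j \<omega>)\<^sup>2) / real n \<le> K}"
  have S: "finite S" by (simp add: S_def)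
  have "(\<Sum>i=1..n. (truncated_weight n K \<delta> i \<omega>)\<^sup>2) \<le> (\<Sum>i\<in>S. (\<gamma> n i \<omega>)\<^sup>2 / real n)"
  proof -
    have "(\<Sum>i=1..n. (truncated_weight n K \<delta> i \<omega>)\<^sup>2) \<le> (\<Sum>i=1..n. if i \<in> S then (\<gamma> n i \<omega>)\<^sup>2 / real n else 0)"
      by (intro sum_mono) (auto simp: truncated_weight_def S_def power_divide)
    also have "\<dots> = (\<Sum>i\<in>{1..n} \<inter> S. (\<gamma> n i \<omega>)\<^sup>2 / real n)" by (rule sum.inter_restrict[symmetric]) simp
    also have "{1..n} \<inter> S = S" by (auto simp: S_def)
    finally show ?thesis .
  qed
  also have "\<dots> \<le> K"
  proof (cases "S = {}")
    case False
    define s where "s = Max S"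
    have s: "s \<in> S" "S \<subseteq> {1..s}" using S False Max_in[of S] by (auto simp: s_def S_def)
    have "(\<Sum>i\<in>S. (\<gamma> n i \<omega>)\<^sup>2 / real n) \<le> (\<Sum>i=1..s. (\<gamma> n i \<omega>)\<^sup>2 / real n)"
      using s by (intro sum_mono2) auto
    also have "\<dots> \<le> K" using s(1) by (simp add: S_def sum_divide_distrib)
    finally show ?thesis .
  qed (use assms in simp)
  finally show ?thesis .
qed

lemma U_tilde_eq_shifted_sum:
  assumes "\<And>i. i \<in> {1..n} \<Longrightarrow> c i \<omega> = \<gamma> n i \<omega> / sqrt (real n)"
  shows "U_tilde \<eta> \<gamma> \<tau> \<xi> H n \<omega> t = shifted_sum n c (\<tau> n) (\<xi> n) t \<omega>"
    and "U_star \<eta> \<gamma> H n \<omega> t = shifted_sum n c (\<lambda>_ _. 0) (\<lambda>_ _. 0) t \<omega>"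
  unfolding U_tilde_def U_star_def shifted_sum_def sum_distrib_left
  by (auto intro!: sum.cong simp: assms)

end

context lipschitz_moment_array begin

lemma deviation_bound_tendsto_0:
  "(\<lambda>m::nat. 39 * \<mu> * ((35200000 * K\<^sup>2 * (C / m) + 8 * K\<^sup>2 * sqrt (18 * C * \<mu> / m) + 3 * (1 / m)\<^sup>2 *
      K) / \<epsilon> ^ 4)) \<longlonglongrightarrow> 0"
proof -
  have 1: "(\<lambda>m::nat. a / m) \<longlonglongrightarrow> 0" for a :: real by (rule lim_const_over_n)
  have "(\<lambda>m::nat. 39 * \<mu> * ((35200000 * K\<^sup>2 * (C / m) + 8 * K\<^sup>2 * sqrt (18 * C * \<mu> / m) + 3 * (1 /
      m)\<^sup>2 * K) * (1 / \<epsilon> ^ 4)))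
    \<longlonglongrightarrow> 39 * \<mu> * ((35200000 * K\<^sup>2 * 0 + 8 * K\<^sup>2 * sqrt 0 + 3 * 0\<^sup>2 * K) * (1 / \<epsilon> ^ 4))"
    by (intro tendsto_mult tendsto_add tendsto_const tendsto_real_sqrt tendsto_power 1)
  then show ?thesis by simp
qed

text \<open>
  K is chosen first, from the boundedness of the mean square weight; then the mesh 1 / m, which is
  also the truncation level \<open>\<delta>\<close>, from K; and n last, from m. Five exceptional
  events of probability at most r / 8 remain.
\<close>

lemma U_difference_null_in_prob:
  assumes gamma_sq: "bounded_in_prob M (\<lambda>n \<omega>. 1 / real n * (\<Sum>i=1..n. (\<gamma> n i \<omega>)\<^sup>2))"
    and gamma_max: "null_in_prob M (\<lambda>n \<omega>. MAX i\<in>{1..n}. 1 / sqrt (real n) * \<bar>\<gamma> n i \<omega>\<bar>)"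
    and xi_max: "null_in_prob M (\<lambda>n \<omega>. MAX i\<in>{1..n}. \<bar>\<xi> n i \<omega>\<bar>)"
    and tau_max: "null_in_prob M (\<lambda>n \<omega>. MAX i\<in>{1..n}. \<bar>\<tau> n i \<omega>\<bar>)"
  shows "null_in_prob M (\<lambda>n \<omega>. SUP x. \<bar>U_tilde \<eta> \<gamma> \<tau> \<xi> H n \<omega> x - U_star \<eta> \<gamma> H n \<omega> x\<bar>)"
  unfolding null_in_prob_def
proof (intro conjI allI impI U_difference_SUP_measurable LIMSEQ_I)
  fix \<epsilon>' r :: real assume \<epsilon>': "0 < \<epsilon>'" and r: "0 < r"
  define \<epsilon> where "\<epsilon> = \<epsilon>' / 5"
  have \<epsilon>: "0 < \<epsilon>" using \<epsilon>' by (simp add: \<epsilon>_def)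
  define G where "G n \<omega> = 1 / real n * (\<Sum>i=1..n. (\<gamma> n i \<omega>)\<^sup>2)" for n \<omega>
  define D where "D n \<omega> = (SUP x. \<bar>U_tilde \<eta> \<gamma> \<tau> \<xi> H n \<omega> x - U_star \<eta> \<gamma> H n \<omega> x\<bar>)" for n \<omega>
  obtain K0 where K0: "\<And>n. 1 \<le> n \<Longrightarrow> measure M {\<omega> \<in> space M. \<bar>G n \<omega>\<bar> > K0} \<le> r / 8"
    using gamma_sq r unfolding bounded_in_prob_def G_def by (meson divide_pos_pos zero_less_numeral)
  define K where "K = max 0 K0"
  have K: "0 \<le> K" "K0 \<le> K" by (auto simp: K_def)
  have "\<forall>\<^sub>F m in sequentially. 39 * \<mu> * ((35200000 * K\<^sup>2 * (C / real m) + 8 * K\<^sup>2 * sqrt (18 * C * \<mu>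
      / real m) + 3 * (1 / real m)\<^sup>2 * K) / \<epsilon> ^ 4) < r / 8"
    by (rule order_tendstoD(2)[OF deviation_bound_tendsto_0]) (use r in simp)
  then have "\<forall>\<^sub>F m in sequentially. 6 \<le> m \<and> 39 * \<mu> * ((35200000 * K\<^sup>2 * (C / real m) + 8 * K\<^sup>2 *
      sqrt (18 * C * \<mu> / real m) + 3 * (1 / real m)\<^sup>2 * K) / \<epsilon> ^ 4) < r / 8"
    by (intro eventually_conj eventually_ge_at_top)
  then obtain m where m: "6 \<le> m" and small: "39 * \<mu> * ((35200000 * K\<^sup>2 * (C / real m) + 8 * K\<^sup>2 *
      sqrt (18 * C * \<mu> / real m) + 3 * (1 / real m)\<^sup>2 * K) / \<epsilon> ^ 4) < r / 8"
    by (auto simp: eventually_sequentially)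
  define \<delta> where "\<delta> = 1 / real m"
  have \<delta>: "0 < \<delta>" using m by (simp add: \<delta>_def)
  have ev: "\<forall>\<^sub>F n in sequentially. measure M {\<omega> \<in> space M. \<delta> < \<bar>X n \<omega>\<bar>} < r / 8" if "null_in_prob M X" for X
    using that \<delta> r order_tendstoD(2)[of "\<lambda>n. measure M {\<omega> \<in> space M. \<delta> < \<bar>X n \<omega>\<bar>}" 0 sequentially "r / 8"]
    unfolding null_in_prob_def by simp
  from eventually_conj[OF ev[OF gamma_max] eventually_conj[OF ev[OF xi_max] ev[OF tau_max]]]
  obtain N where N: "\<And>n. N \<le> n \<Longrightarrow>
      measure M {\<omega> \<in> space M. \<delta> < \<bar>MAX i\<in>{1..n}. 1 / sqrt (real n) * \<bar>\<gamma> n i \<omega>\<bar>\<bar>} < r / 8 \<and>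
      measure M {\<omega> \<in> space M. \<delta> < \<bar>MAX i\<in>{1..n}. \<bar>\<xi> n i \<omega>\<bar>\<bar>} < r / 8 \<and>
      measure M {\<omega> \<in> space M. \<delta> < \<bar>MAX i\<in>{1..n}. \<bar>\<tau> n i \<omega>\<bar>\<bar>} < r / 8"
    unfolding eventually_sequentially by blast
  show "\<exists>N. \<forall>n\<ge>N. norm (measure M {\<omega> \<in> space M. \<epsilon>' < \<bar>SUP x. \<bar>U_tilde \<eta> \<gamma> \<tau> \<xi> H n \<omega> x - U_star \<eta> \<gamma> H
      n \<omega> x\<bar>\<bar>} - 0) < r"
  proof (intro exI[of _ "max 1 N"] allI impI)
    fix n assume "max 1 N \<le> n"
    then have n: "1 \<le> n" "N \<le> n" by auto
    define c where "c = truncated_weight n K \<delta>"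
    have pred: "predictable n c" "predictable n (\<tau> n)" "predictable n (\<xi> n)"
      unfolding c_def using weights_adapted
      by (auto intro: predictable_truncated_weight) (auto simp: predictable_def)
    have csmall: "\<bar>\<tau> n i \<omega>\<bar> \<le> 1 / real m \<and> \<bar>\<xi> n i \<omega>\<bar> \<le> 1 / real m" if "c i \<omega> \<noteq> 0" for i \<omega>
      using that by (auto simp: c_def truncated_weight_def \<delta>_def split: if_splits)
    have cap: "(c i \<omega>)\<^sup>2 \<le> (1 / real m)\<^sup>2" for i \<omega>
    proof -
      have "\<bar>c i \<omega>\<bar> \<le> \<bar>1 / real m\<bar>"
        by (auto simp: c_def truncated_weight_def \<delta>_def abs_divide)
      then show ?thesis by (simp only: abs_le_square_iff)
    qed
    have "\<exists>B\<in>sets M. emeasure M B \<le> ennreal (39 * \<mu> *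
      ((35200000 * K\<^sup>2 * (C / m) + 8 * K\<^sup>2 * sqrt (18 * C * \<mu> / m) + 3 * (1 / real m)\<^sup>2 * K) / \<epsilon> ^ 4)) \<and>
      (\<forall>\<omega>\<in>space M - B. \<forall>t.
        \<bar>shifted_sum n c (\<tau> n) (\<xi> n) t \<omega> - shifted_sum n c (\<lambda>_ _. 0) (\<lambda>_ _. 0) t \<omega>\<bar> \<le> 5 * \<epsilon>)"
      unfolding c_def
      by (rule uniform_closeness[OF pred[unfolded c_def] m csmall[unfolded c_def]
          truncated_weight_budget[OF K(1)] cap[unfolded c_def] \<epsilon>])
    then obtain B where B: "B \<in> sets M" "emeasure M B \<le> ennreal (r / 8)"
      "\<And>\<omega> t. \<omega> \<in> space M - B \<Longrightarrow> \<bar>shifted_sum n c (\<tau> n) (\<xi> n) t \<omega> - shifted_sum n c (\<lambda>_ _. 0) (\<lambda>_ _.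
          0) t \<omega>\<bar> \<le> 5 * \<epsilon>"
      using ennreal_leI[OF less_imp_le[OF small]] by (meson order_trans)
    define E1 where "E1 = {\<omega> \<in> space M. \<bar>G n \<omega>\<bar> > K0}"
    define E2 where "E2 = {\<omega> \<in> space M. \<delta> < \<bar>MAX i\<in>{1..n}. 1 / sqrt (real n) * \<bar>\<gamma> n i \<omega>\<bar>\<bar>}"
    define E3 where "E3 = {\<omega> \<in> space M. \<delta> < \<bar>MAX i\<in>{1..n}. \<bar>\<xi> n i \<omega>\<bar>\<bar>}"
    define E4 where "E4 = {\<omega> \<in> space M. \<delta> < \<bar>MAX i\<in>{1..n}. \<bar>\<tau> n i \<omega>\<bar>\<bar>}"
    have Xm: "X n \<in> borel_measurable M" if "null_in_prob M X" for X
      using that n by (simp add: null_in_prob_def)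
    have ev_sets: "{\<omega> \<in> space M. a < \<bar>X \<omega>\<bar>} \<in> sets M" if [measurable]: "X \<in> borel_measurable M" for
        X :: "'a \<Rightarrow> real" and a
      by measurable
    have "G n \<in> borel_measurable M" using gamma_sq n unfolding bounded_in_prob_def G_def[abs_def] by simp
    then have E_sets: "E1 \<in> sets M" "E2 \<in> sets M" "E3 \<in> sets M" "E4 \<in> sets M"
      unfolding E1_def E2_def E3_def E4_def
      using Xm[OF gamma_max] Xm[OF xi_max] Xm[OF tau_max] by (auto intro: ev_sets)
    have E_le: "measure M E1 \<le> r / 8" "measure M E2 \<le> r / 8" "measure M E3 \<le> r / 8" "measure M E4 \<le> r / 8"
      unfolding E1_def E2_def E3_def E4_def using K0[OF n(1)] N[OF n(2)] by (auto intro: less_imp_le)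
    have "measure M B \<le> r / 8" using B(2) r by (simp add: emeasure_eq_measure ennreal_le_iff)
    moreover have "{\<omega> \<in> space M. \<epsilon>' < \<bar>D n \<omega>\<bar>} \<subseteq> B \<union> (E1 \<union> (E2 \<union> (E3 \<union> E4)))"
    proof (rule ccontr)
      assume "\<not> ?thesis"
      then obtain \<omega> where w: "\<omega> \<in> space M" "\<epsilon>' < \<bar>D n \<omega>\<bar>" "\<omega> \<notin> B" "\<omega> \<notin> E1" "\<omega> \<notin> E2" "\<omega> \<notin> E3" "\<omega> \<notin> E4"
        by auto
      have MAX_le: "f i \<le> \<delta>" if "\<bar>MAX i\<in>{1..n}. f i\<bar> \<le> \<delta>" "i \<in> {1..n}" for f :: "nat \<Rightarrow> real" and i
      proof -
        have "f i \<le> (MAX i\<in>{1..n}. f i)" using that(2) by (intro Max_ge) auto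
        then show ?thesis using that(1) by linarith
      qed
      have c: "c i \<omega> = \<gamma> n i \<omega> / sqrt (real n)" if i: "i \<in> {1..n}" for i
      proof -
        have "(\<Sum>j=1..i. (\<gamma> n j \<omega>)\<^sup>2) / real n \<le> (\<Sum>j=1..n. (\<gamma> n j \<omega>)\<^sup>2) / real n"
          using i by (intro divide_right_mono sum_mono2) auto
        also have "\<dots> = G n \<omega>" by (simp add: G_def)
        also have "\<bar>G n \<omega>\<bar> \<le> K0" using w(1,4) by (simp add: E1_def not_less)
        then have "G n \<omega> \<le> K" using K(2) by linarith
        finally have 1: "(\<Sum>j=1..i. (\<gamma> n j \<omega>)\<^sup>2) / real n \<le> K" .
        have 2: "1 / sqrt (real n) * \<bar>\<gamma> n i \<omega>\<bar> \<le> \<delta>"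
          by (rule MAX_le[OF _ i]) (use w(1,5) in \<open>auto simp: E2_def not_less\<close>)
        have 3: "\<bar>\<xi> n i \<omega>\<bar> \<le> \<delta>"
          by (rule MAX_le[OF _ i]) (use w(1,6) in \<open>auto simp: E3_def not_less\<close>)
        have 4: "\<bar>\<tau> n i \<omega>\<bar> \<le> \<delta>"
          by (rule MAX_le[OF _ i]) (use w(1,7) in \<open>auto simp: E4_def not_less\<close>)
        show ?thesis using 1 2 3 4 by (simp add: c_def truncated_weight_def)
      qed
      have le: "\<bar>U_tilde \<eta> \<gamma> \<tau> \<xi> H n \<omega> x - U_star \<eta> \<gamma> H n \<omega> x\<bar> \<le> \<epsilon>'" for x
        using B(3)[of \<omega> x] w(1,3) U_tilde_eq_shifted_sum[of n c \<omega> x] c by (simp add: \<epsilon>_def)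
      have "D n \<omega> \<le> \<epsilon>'" unfolding D_def by (rule cSUP_least) (use le in auto)
      moreover have "0 \<le> D n \<omega>"
      proof -
        have "0 \<le> \<bar>U_tilde \<eta> \<gamma> \<tau> \<xi> H n \<omega> 0 - U_star \<eta> \<gamma> H n \<omega> 0\<bar>" by simp
        also have "\<dots> \<le> D n \<omega>" unfolding D_def
          by (rule cSUP_upper) (use le in \<open>auto intro!: bdd_aboveI2\<close>)
        finally show ?thesis .
      qed
      ultimately show False using w(2) by simp
    qed
    then have "measure M {\<omega> \<in> space M. \<epsilon>' < \<bar>D n \<omega>\<bar>} \<le> measure M (B \<union> (E1 \<union> (E2 \<union> (E3 \<union> E4))))"
      using B(1) E_sets by (intro finite_measure_mono) auto
    moreover have "measure M (B \<union> (E1 \<union> (E2 \<union> (E3 \<union> E4)))) \<le> measure M B + (measure M E1 + (measure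
        M E2 + (measure M E3 + measure M E4)))"
      using B(1) E_sets by (intro order_trans[OF measure_Un_le] add_left_mono measure_Un_le) auto
    ultimately have "measure M {\<omega> \<in> space M. \<epsilon>' < \<bar>D n \<omega>\<bar>} < r" using E_le r by linarith
    then show "norm (measure M {\<omega> \<in> space M. \<epsilon>' < \<bar>SUP x. \<bar>U_tilde \<eta> \<gamma> \<tau> \<xi> H n \<omega> x - U_star \<eta> \<gamma> H n
        \<omega> x\<bar>\<bar>} - 0) < r"
      by (simp add: D_def)
  qed
qed

end

theorem theorem4p1:
  fixes M :: "'a measure"
    and \<eta> \<gamma> \<tau> \<xi> :: "nat \<Rightarrow> nat \<Rightarrow> 'a \<Rightarrow> real"
    and \<A> :: "nat \<Rightarrow> nat \<Rightarrow> 'a measure"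
    and H h :: "real \<Rightarrow> real"
  assumes array: "weighted_array M \<eta> \<gamma> \<tau> \<xi> \<A> H"
    and density: "is_density_of h H"
    and density_pos: "AE x in lborel. h x > 0"
    and density_bounded: "bdd_above (range h)"
    and first_moment: "integrable lborel (\<lambda>x. \<bar>x\<bar> * h x)"
    and gamma_sq: "bounded_in_prob M (\<lambda>n \<omega>. 1 / real n * (\<Sum>i=1..n. (\<gamma> n i \<omega>)\<^sup>2))"
    and gamma_max: "null_in_prob M (\<lambda>n \<omega>. MAX i\<in>{1..n}. 1 / sqrt (real n) * \<bar>\<gamma> n i \<omega>\<bar>)"
    and xi_max: "null_in_prob M (\<lambda>n \<omega>. MAX i\<in>{1..n}. \<bar>\<xi> n i \<omega>\<bar>)"
    and tau_max: "null_in_prob M (\<lambda>n \<omega>. MAX i\<in>{1..n}. \<bar>\<tau> n i \<omega>\<bar>)"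
  shows "null_in_prob M
           (\<lambda>n \<omega>. SUP x\<in>(UNIV :: real set). \<bar>U_tilde \<eta> \<gamma> \<tau> \<xi> H n \<omega> x - U_star \<eta> \<gamma> H n \<omega> x\<bar>)"
proof -
  interpret weighted_array M \<eta> \<gamma> \<tau> \<xi> \<A> H by (rule array)
  obtain C \<mu> where "lipschitz_moment_array M \<eta> \<gamma> \<tau> \<xi> \<A> H C \<mu>"
    using lipschitz_moment_array_of_density[OF density density_bounded first_moment] by blast
  then show ?thesis
    using gamma_sq gamma_max xi_max tau_max by (rule lipschitz_moment_array.U_difference_null_in_prob)
qed

end
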